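(* A function $f:\mathbb{R}\to\mathbb{R}$ is $\mathsf{SITBM}$-computable if and only if it is $\mathsf{SSITBM}$-computable.
   Context: A BSS-program is a finite numbered list of instructions acting on registers $R_1,\dots,R_n$ that contain real numbers; each instruction either replaces the content of a register by the value of a rational function, with rational coefficients, of the register contents, or performs a conditional jump depending on the register contents (e.g. "if $R_i>0$ go to line $k$, else go to line $l$"). The machines below run BSS-programs for transfinite ordinal time. At time $\alpha$ the snapshot is $C_\alpha=(R_1(\alpha),\dots,R_n(\alpha),I(\alpha))$, where $R_i(\alpha)\in\mathbb{R}$ is the content of register $R_i$ and $I(\alpha)$ is the program counter. At successor times the machine performs the current instruction as usual; it halts when the program counter points to no instruction. At a limit time $\lambda$, $I(\lambda)=\liminf_{\alpha<\lambda}I(\alpha)$, and $R_i(\lambda)$ is determined from the sequence $R_i^\lambda=(R_i(\alpha))_{\alpha<\lambda}$ by the limit rule of the model. If some $R_i(\lambda)$ is not defined (as a real number), the machine crashes and the computation is considered divergent. For a sequence $f:\lambda\to\mathbb{R}$: a real $\ell$ is a finite limit point if for all $\beta<\lambda$ and $\varepsilon>0$ there is $\beta<\gamma<\lambda$ with $|f(\gamma)-\ell|<\varepsilon$; $+\infty$ (resp. $-\infty$) is an infinite limit point if for all $x\in\mathbb{R}$ and $\beta<\lambda$ there is $\beta<\gamma<\lambda$ with $f(\gamma)>x$ (resp. $f(\gamma)<x$); $+\infty$ (resp. $-\infty$) is an infinite strong limit point if for every $x\in\mathbb{R}$ there is $\beta<\lambda$ with $f(\gamma)>x$ (resp. $f(\gamma)<x$)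 for all $\beta<\gamma<\lambda$. $\mathrm{LimP}(f)$ is the set of finite and infinite limit points, and $\mathrm{sLimP}(f)$ is the set of finite limit points and infinite strong limit points, both subsets of $\mathbb{R}\cup\{\pm\infty\}$. Limit rules. $\mathsf{SITBM}$: $R_i(\lambda)=\min(\mathrm{LimP}(R_i^\lambda))$ if $\min(\mathrm{sLimP}(R_i^\lambda))\in\mathbb{R}$; $R_i(\lambda)=0$ if $\min(\mathrm{sLimP}(R_i^\lambda))$ is an infinite strong limit; undefined otherwise. $\mathsf{SSITBM}$: $R_i(\lambda)=\min(\mathrm{LimP}(R_i^\lambda))$ if $\min(\mathrm{LimP}(R_i^\lambda))\in\mathbb{R}$; $R_i(\lambda)=0$ if $\min(\mathrm{LimP}(R_i^\lambda))$ is infinite. For either model $\Gamma$, $f:\mathbb{R}\to\mathbb{R}$ is $\Gamma$-computable if there is a BSS-program whose $\Gamma$-computation on input $x$ (in $R_1$, the other registers being $0$) halts with output $f(x)$ (in $R_1$) for every $x\in\mathbb{R}$. *)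

theory Defs
  imports Complex_Main "HOL-Library.Extended_Real"
begin

datatype (vars: 'v) rat_poly =
    Const rat
  | Var 'v
  | Add "'v rat_poly" "'v rat_poly"
  | Mul "'v rat_poly" "'v rat_poly"

primrec poly_val :: "'v rat_poly \<Rightarrow> ('v \<Rightarrow> real) \<Rightarrow> real" where
  "poly_val (Const c) \<rho> = of_rat c"
| "poly_val (Var v) \<rho> = \<rho> v"
| "poly_val (Add p q) \<rho> = poly_val p \<rho> + poly_val q \<rho>"
| "poly_val (Mul p q) \<rho> = poly_val p \<rho> * poly_val q \<rho>"

text \<open>
  \<open>Assign i p q\<close> is the instruction \<open>R_i := p/q\<close>, and \<open>Branch i k l\<close> is the instruction
  ``if \<open>R_i > 0\<close> go to line \<open>k\<close>, else go to line \<open>l\<close>''.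
\<close>

datatype instr =
    Assign nat "nat rat_poly" "nat rat_poly"
  | Branch nat nat nat

type_synonym program = "instr list"

text \<open>
  The registers are numbered from 1 to \<open>n\<close>, the lines of a program from 0. A denominator has to
  be a nonzero polynomial; over the reals this means that it is not the zero function.
\<close>

primrec wf_instr :: "nat \<Rightarrow> instr \<Rightarrow> bool" where
  "wf_instr n (Assign i p q) \<longleftrightarrow>
     i \<in> {1..n} \<and> vars p \<subseteq> {1..n} \<and> vars q \<subseteq> {1..n} \<and> (\<exists>\<rho>. poly_val q \<rho> \<noteq> 0)"
| "wf_instr n (Branch i k l) \<longleftrightarrow> i \<in> {1..n}"

definition BSS_program :: "nat \<Rightarrow> program \<Rightarrow> bool" where
  "BSS_program n P \<longleftrightarrow> 1 \<le> n \<and> (\<forall>c\<in>set P. wf_instr n c)"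

text \<open>A snapshot consists of the register contents and the program counter.\<close>

type_synonym snapshot = "(nat \<Rightarrow> real) \<times> nat"

definition halted :: "program \<Rightarrow> snapshot \<Rightarrow> bool" where
  "halted P c \<longleftrightarrow> length P \<le> snd c"

text \<open>
  There is no next snapshot if the machine has halted or if the rational function to be evaluated
  is undefined at the current register contents.
\<close>

fun exec :: "instr \<Rightarrow> snapshot \<Rightarrow> snapshot option" where
  "exec (Assign i p q) (R, I) =
     (if poly_val q R = 0 then None else Some (R(i := poly_val p R / poly_val q R), Suc I))"
| "exec (Branch i k l) (R, I) = Some (R, if R i > 0 then k else l)"

definition step :: "program \<Rightarrow> snapshot \<Rightarrow> snapshot option" where
  "step P c = (if halted P c then None else exec (P ! snd c) c)"

definition init :: "real \<Rightarrow> snapshot" where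
  "init x = ((\<lambda>i. if i = 1 then x else 0), 0)"

text \<open>
  Ordinals are represented by elements of well-orders \<open>r\<close> on subsets of a type \<open>'o\<close>: an element
  \<open>t\<close> of \<open>Field r\<close> stands for the order type of \<open>underS r t\<close>, the set of its strict predecessors.
  A sequence of length \<open>t\<close> is a function on \<open>'o\<close> of which only the values on \<open>underS r t\<close>
  matter. In what follows, \<open>s \<in> underS r t\<close> is the relation \<open>s < t\<close>.
\<close>

definition fin_limit_point :: "'o rel \<Rightarrow> 'o \<Rightarrow> ('o \<Rightarrow> real) \<Rightarrow> real \<Rightarrow> bool" where
  "fin_limit_point r t f l \<longleftrightarrow>
     (\<forall>b\<in>underS r t. \<forall>\<epsilon>>0. \<exists>g\<in>underS r t. b \<in> underS r g \<and> \<bar>f g - l\<bar> < \<epsilon>)"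

definition pinf_limit_point :: "'o rel \<Rightarrow> 'o \<Rightarrow> ('o \<Rightarrow> real) \<Rightarrow> bool" where
  "pinf_limit_point r t f \<longleftrightarrow>
     (\<forall>x. \<forall>b\<in>underS r t. \<exists>g\<in>underS r t. b \<in> underS r g \<and> f g > x)"

definition minf_limit_point :: "'o rel \<Rightarrow> 'o \<Rightarrow> ('o \<Rightarrow> real) \<Rightarrow> bool" where
  "minf_limit_point r t f \<longleftrightarrow>
     (\<forall>x. \<forall>b\<in>underS r t. \<exists>g\<in>underS r t. b \<in> underS r g \<and> f g < x)"

definition pinf_strong_limit_point :: "'o rel \<Rightarrow> 'o \<Rightarrow> ('o \<Rightarrow> real) \<Rightarrow> bool" where
  "pinf_strong_limit_point r t f \<longleftrightarrow>
     (\<forall>x. \<exists>b\<in>underS r t. \<forall>g\<in>underS r t. b \<in> underS r g \<longrightarrow> f g > x)"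

definition minf_strong_limit_point :: "'o rel \<Rightarrow> 'o \<Rightarrow> ('o \<Rightarrow> real) \<Rightarrow> bool" where
  "minf_strong_limit_point r t f \<longleftrightarrow>
     (\<forall>x. \<exists>b\<in>underS r t. \<forall>g\<in>underS r t. b \<in> underS r g \<longrightarrow> f g < x)"

definition LimP :: "'o rel \<Rightarrow> 'o \<Rightarrow> ('o \<Rightarrow> real) \<Rightarrow> ereal set" where
  "LimP r t f = {ereal l | l. fin_limit_point r t f l} \<union>
     {e. e = \<infinity> \<and> pinf_limit_point r t f} \<union> {e. e = -\<infinity> \<and> minf_limit_point r t f}"

definition sLimP :: "'o rel \<Rightarrow> 'o \<Rightarrow> ('o \<Rightarrow> real) \<Rightarrow> ereal set" where
  "sLimP r t f = {ereal l | l. fin_limit_point r t f l} \<union>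
     {e. e = \<infinity> \<and> pinf_strong_limit_point r t f} \<union>
     {e. e = -\<infinity> \<and> minf_strong_limit_point r t f}"

text \<open>
  A relation, since a minimum need not exist: \<open>sLimP\<close> can be empty, and it can be unbounded below
  without containing \<open>-\<infinity>\<close>.
\<close>

definition is_min :: "'a::linorder set \<Rightarrow> 'a \<Rightarrow> bool" where
  "is_min S m \<longleftrightarrow> m \<in> S \<and> (\<forall>y\<in>S. m \<le> y)"

text \<open>
  \<open>\<Gamma> r t f v\<close> says that the limit rule \<open>\<Gamma>\<close> assigns the real \<open>v\<close> to the sequence \<open>f\<close> of limit
  length \<open>t\<close>; the rule is undefined at \<open>f\<close> if there is no such \<open>v\<close>. In particular, \<open>SITBM\<close> is
  undefined if the minimum of \<open>sLimP\<close> is real but that of \<open>LimP\<close> is \<open>-\<infinity>\<close>.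
\<close>

type_synonym 'o limit_rule = "'o rel \<Rightarrow> 'o \<Rightarrow> ('o \<Rightarrow> real) \<Rightarrow> real \<Rightarrow> bool"

definition SITBM :: "'o limit_rule" where
  "SITBM r t f v \<longleftrightarrow>
     (\<exists>m::real. is_min (sLimP r t f) (ereal m)) \<and> is_min (LimP r t f) (ereal v) \<or>
     (is_min (sLimP r t f) \<infinity> \<or> is_min (sLimP r t f) (-\<infinity>)) \<and> v = 0"

definition SSITBM :: "'o limit_rule" where
  "SSITBM r t f v \<longleftrightarrow>
     is_min (LimP r t f) (ereal v) \<or>
     (is_min (LimP r t f) \<infinity> \<or> is_min (LimP r t f) (-\<infinity>)) \<and> v = 0"

text \<open>
  The supremum on \<open>nat\<close> is meaningful here because program counters before a limit time of a
  computation are bounded by the length of the program.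
\<close>

definition liminf_pc :: "'o rel \<Rightarrow> 'o \<Rightarrow> ('o \<Rightarrow> nat) \<Rightarrow> nat" where
  "liminf_pc r t f = (SUP b\<in>underS r t. INF g\<in>{g\<in>underS r t. (b, g) \<in> r}. f g)"

definition zero_time :: "'o rel \<Rightarrow> 'o \<Rightarrow> bool" where
  "zero_time r t \<longleftrightarrow> underS r t = {}"

definition succ_time :: "'o rel \<Rightarrow> 'o \<Rightarrow> 'o \<Rightarrow> bool" where
  "succ_time r s t \<longleftrightarrow> s \<in> underS r t \<and> underS r t = under r s"

definition limit_time :: "'o rel \<Rightarrow> 'o \<Rightarrow> bool" where
  "limit_time r t \<longleftrightarrow> \<not> zero_time r t \<and> (\<nexists>s. succ_time r s t)"

text \<open>
  \<open>computation \<Gamma> n P x r C\<close>: the snapshots \<open>C t\<close>, for \<open>t\<close> in the well-order \<open>r\<close>, form an initial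
  part of the computation of \<open>P\<close> with input \<open>x\<close>. Nothing comes after a halted snapshot, after an
  undefined rational function or after a crash, as the required next snapshot does not exist.
\<close>

definition computation ::
  "'o limit_rule \<Rightarrow> nat \<Rightarrow> program \<Rightarrow> real \<Rightarrow> 'o rel \<Rightarrow> ('o \<Rightarrow> snapshot) \<Rightarrow> bool" where
  "computation \<Gamma> n P x r C \<longleftrightarrow> Well_order r \<and>
     (\<forall>t\<in>Field r.
        (zero_time r t \<longrightarrow> C t = init x) \<and>
        (\<forall>s. succ_time r s t \<longrightarrow> step P (C s) = Some (C t)) \<and>
        (limit_time r t \<longrightarrow>
           snd (C t) = liminf_pc r t (\<lambda>s. snd (C s)) \<and>
           (\<forall>i\<in>{1..n}. \<Gamma> r t (\<lambda>s. fst (C s) i) (fst (C t) i))))"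

definition halts_with ::
  "'o limit_rule \<Rightarrow> nat \<Rightarrow> program \<Rightarrow> real \<Rightarrow> real \<Rightarrow> bool" where
  "halts_with \<Gamma> n P x y \<longleftrightarrow>
     (\<exists>r C. computation \<Gamma> n P x r C \<and> (\<exists>t\<in>Field r. halted P (C t) \<and> fst (C t) 1 = y))"

text \<open>
  The type \<open>'o\<close> bounds the length of computations: the times are the ordinals of cardinality
  at most that of \<open>'o\<close>. HOL has no quantification over types, so a statement about all ordinal
  times is made for an arbitrary infinite type \<open>'o\<close>.
\<close>

definition computable :: "'o limit_rule \<Rightarrow> (real \<Rightarrow> real) \<Rightarrow> bool" where
  "computable \<Gamma> f \<longleftrightarrow> (\<exists>n P. BSS_program n P \<and> (\<forall>x. halts_with \<Gamma> n P x (f x)))"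

end

theory Submission
  imports Defs
begin

text \<open>The limit rule applies to every register, scratch registers included, and it sees every
  intermediate content. A quantity that may be unbounded below must therefore not be stored, even
  for a single step, wherever this can recur cofinally below a limit; this dictates the form of the
  scratch computations. The map \<open>enc\<close> suits the purpose because it is strictly
  increasing and rational with rational coefficients on each of the two half-lines, so that one sign
  test suffices to evaluate it. Moreover \<open>1 + \<bar>x\<bar>\<close> equals
  \<open>1 / (1 - \<bar>enc x\<bar>)\<close>, is positive, and recovers x as a product that can be
  expanded inside a polynomial. Since all blocks take the same number of steps, the refined time
  scale can be fixed before the simulating run is known. As the type of times bounds the length of
  computations, the refined times have to be elements of the same type; for an infinite type a
  bijection with its product with \<open>nat\<close> provides them.\<close>

text \<open>
  The two limit rules agree where \<open>SITBM\<close> is defined, and \<open>SITBM\<close> is undefined exactly on the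
  sequences that are unbounded below without tending to \<open>-\<infinity>\<close>. Hence every halting \<open>SITBM\<close>
  computation is also an \<open>SSITBM\<close> computation. Conversely, an \<open>SITBM\<close> can simulate an \<open>SSITBM\<close> if
  it keeps \<open>x / (1 + \<bar>x\<bar>)\<close> in place of each register content \<open>x\<close>. The limit inferior of the
  compressed values always exists, and it is \<open>-1\<close> or \<open>1\<close> iff that of the original values is
  infinite, in which case the simulated register is reset to \<open>0\<close>. The values \<open>-1\<close> and \<open>1\<close> that are
  visible between a limit time and this reset do no harm at later limits: \<open>-1\<close> occurs only if
  the original values are unbounded below anyway, and \<open>1\<close> is above all the values that follow it.
  As each line of the program becomes a block that is entered at its first line and left at its
  end, the limits of the two program counters correspond to each other.
\<close>

subsection \<open>Well-orders and limit times\<close>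

lemma underS_FieldD: "s \<in> underS r t \<Longrightarrow> s \<in> Field r \<and> t \<in> Field r"
  unfolding underS_def Field_def by auto

lemma underS_irrefl [simp]: "t \<notin> underS r t"
  by (simp add: underS_def)

lemma underS_trans:
  "Well_order r \<Longrightarrow> s \<in> underS r t \<Longrightarrow> t \<in> underS r u \<Longrightarrow> s \<in> underS r u"
  unfolding underS_def order_on_defs antisym_def trans_def by blast

lemma underS_total:
  "Well_order r \<Longrightarrow> s \<in> Field r \<Longrightarrow> t \<in> Field r \<Longrightarrow>
    s \<in> underS r t \<or> s = t \<or> t \<in> underS r s"
  unfolding underS_def order_on_defs total_on_def by blast

lemma wf_underS: "Well_order r \<Longrightarrow> wf {(s, t). s \<in> underS r t}"
proof -
  assume "Well_order r"
  then have "wf (r - Id)"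
    by (simp add: well_order_on_def)
  moreover have "{(s, t). s \<in> underS r t} = r - Id"
    by (auto simp: underS_def)
  ultimately show ?thesis
    by simp
qed

lemma under_eq: "Well_order r \<Longrightarrow> t \<in> Field r \<Longrightarrow> under r t = insert t (underS r t)"
  unfolding under_def underS_def order_on_defs refl_on_def by auto

text \<open>The least time after s is its successor, since nothing can lie in between. It is at most
  t because t itself comes after s.\<close>

lemma succ_time_exists:
  assumes r: "Well_order r" and st: "s \<in> underS r t"
  shows "\<exists>s'. succ_time r s s' \<and> s' \<in> under r t"
proof -
  obtain m where m: "s \<in> underS r m" and min: "\<And>y. y \<in> underS r m \<Longrightarrow> s \<notin> underS r y"
    using wfE_min[OF wf_underS[OF r], of t "{g. s \<in> underS r g}"] st by auto
  have fld: "s \<in> Field r" "t \<in> Field r" "m \<in> Field r"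
    using underS_FieldD st m by fast+
  have "underS r m = under r s"
    unfolding under_eq[OF r fld(1)]
  proof (intro equalityI subsetI)
    fix y assume y: "y \<in> underS r m"
    then have "y \<in> Field r"
      by (simp add: underS_FieldD)
    with underS_total[OF r _ fld(1)] min[OF y] show "y \<in> insert s (underS r s)"
      by auto
  qed (use m underS_trans[OF r _ m] in auto)
  moreover have "m \<in> under r t"
    unfolding under_eq[OF r fld(2)] using underS_total[OF r fld(3,2)] min st by blast
  ultimately show ?thesis
    using m unfolding succ_time_def by blast
qed

lemma limit_time_next:
  assumes r: "Well_order r" and "limit_time r t" "s \<in> underS r t"
  shows "\<exists>s'. succ_time r s s' \<and> s' \<in> underS r t"
  using succ_time_exists[OF r assms(3)] assms under_eq[OF r, of t] underS_FieldD[OF assms(3)]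
  unfolding limit_time_def by auto

lemma succ_time_unique:
  assumes r: "Well_order r" and "succ_time r s t" "succ_time r s' t"
  shows "s = s'"
proof -
  have "s \<in> under r s'" "s' \<in> under r s" 
    using assms(2,3) unfolding succ_time_def by auto
  then show ?thesis
    using r unfolding under_def order_on_defs antisym_def by auto
qed

text \<open>The filter of final segments below t. At a limit time, "eventually" and "frequently" in
  it are exactly the quantifier patterns of strong limit points and of limit points.\<close>

definition before :: "'o rel \<Rightarrow> 'o \<Rightarrow> 'o filter" where
  "before r t = (INF b\<in>underS r t. principal {g \<in> underS r t. b \<in> underS r g})"

lemma eventually_before:
  assumes r: "Well_order r" and t: "limit_time r t"
  shows "eventually Q (before r t) \<longleftrightarrow>
    (\<exists>b\<in>underS r t. \<forall>g\<in>underS r t. b \<in> underS r g \<longrightarrow> Q g)"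
  unfolding before_def
proof (subst eventually_INF_base)
  show "underS r t \<noteq> {}"
    using t by (auto simp: limit_time_def zero_time_def)
  fix a b assume ab: "a \<in> underS r t" "b \<in> underS r t"
  \<comment> \<open>The later of a and b serves as c, so the final segments form a filter
    base.\<close>
  have "\<exists>c\<in>{a, b}. \<forall>g. c \<in> underS r g \<longrightarrow> a \<in> underS r g \<and> b \<in> underS r g"
    using underS_total[OF r, of a b] ab underS_FieldD underS_trans[OF r] by (metis insert_iff)
  then obtain c where "c \<in> {a, b}"
    "\<And>g. c \<in> underS r g \<Longrightarrow> a \<in> underS r g \<and> b \<in> underS r g"
    by blast
  then show "\<exists>x\<in>underS r t. principal {g \<in> underS r t. x \<in> underS r g}
      \<le> inf (principal {g \<in> underS r t. a \<in> underS r g})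
          (principal {g \<in> underS r t. b \<in> underS r g})"
    using ab by (intro bexI[of _ c]) auto
qed (auto simp: eventually_principal)

lemma frequently_before:
  assumes "Well_order r" "limit_time r t"
  shows "frequently Q (before r t) \<longleftrightarrow>
    (\<forall>b\<in>underS r t. \<exists>g\<in>underS r t. b \<in> underS r g \<and> Q g)"
  unfolding frequently_def eventually_before[OF assms] by blast

lemma before_neq_bot:
  assumes "Well_order r" "limit_time r t"
  shows "before r t \<noteq> bot"
  unfolding trivial_limit_def eventually_before[OF assms]
  using limit_time_next[OF assms] by (auto simp: succ_time_def)

lemma eventually_before_underS:
  assumes "Well_order r" "limit_time r t" 
  shows "\<forall>\<^sub>F g in before r t. g \<in> underS r t"
  using assms(2) unfolding eventually_before[OF assms] by (auto simp: limit_time_def zero_time_def)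

lemma eventually_before_later:
  assumes "Well_order r" "limit_time r t" "b \<in> underS r t"
  shows "\<forall>\<^sub>F g in before r t. b \<in> underS r g"
  using assms(3) unfolding eventually_before[OF assms(1,2)] by auto

subsection \<open>The limit rules\<close>

text \<open>A real limit inferior, stated without \<open>ereal\<close>: if the limit inferior is
  infinite, no v satisfies this.\<close>

definition has_liminf :: "'a filter \<Rightarrow> ('a \<Rightarrow> real) \<Rightarrow> real \<Rightarrow> bool" where
  "has_liminf F f v \<longleftrightarrow>
    (\<forall>y<v. \<forall>\<^sub>F g in F. y < f g) \<and> (\<forall>y>v. \<exists>\<^sub>F g in F. f g < y)"

lemma has_liminfI:
  assumes "\<And>y. y < v \<Longrightarrow> \<forall>\<^sub>F g in F. y < f g" "\<And>y. y > v \<Longrightarrow> \<exists>\<^sub>F g in F. f g < y"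
  shows "has_liminf F f v"
  using assms by (auto simp: has_liminf_def)

lemma has_liminfD:
  assumes "has_liminf F f v"
  shows "y < v \<Longrightarrow> \<forall>\<^sub>F g in F. y < f g" "y > v \<Longrightarrow> \<exists>\<^sub>F g in F. f g < y"
  using assms by (auto simp: has_liminf_def)

text \<open>The value is the supremum of the eventual strict lower bounds; the two hypotheses make
  this set nonempty and bounded above.\<close>

lemma has_liminf_exists:
  assumes low: "\<forall>\<^sub>F g in F. c \<le> f g" and up: "\<exists>\<^sub>F g in F. f g \<le> C"
  shows "\<exists>v\<in>{c..C}. has_liminf F f v"
proof -
  define A where "A = {y. \<forall>\<^sub>F g in F. y < f g}"
  have A_low: "y \<in> A" if "y < c" for y
    using low that unfolding A_def by (auto elim: eventually_mono)
  have A_up: "y \<le> C" if "y \<in> A" for y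
  proof -
    have "\<exists>\<^sub>F g in F. f g \<le> C \<and> y < f g"
      using up that unfolding A_def by (auto intro: frequently_eventually_frequently)
    then show ?thesis
      by (auto dest: frequently_ex)
  qed
  have "c - 1 \<in> A"
    by (simp add: A_low)
  then have ne: "A \<noteq> {}" and bdd: "bdd_above A"
    using A_up by (auto simp: bdd_above_def)
  have "has_liminf F f (Sup A)"
  proof (rule has_liminfI)
    fix y assume "y < Sup A"
    then obtain z where "z \<in> A" "y < z"
      using less_cSup_iff[OF ne bdd] by blast
    then show "\<forall>\<^sub>F g in F. y < f g"
      unfolding A_def by (auto elim: eventually_mono)
  next
    fix y assume y: "Sup A < y"
    \<comment> \<open>Failure of an eventual strict lower bound gives only \<open>\<le>\<close>
      frequently; the midpoint leaves room for \<open><\<close>.\<close>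
    have "(y + Sup A) / 2 \<notin> A"
    proof
      assume "(y + Sup A) / 2 \<in> A"
      then have "(y + Sup A) / 2 \<le> Sup A"
        using bdd by (rule cSup_upper)
      with y show False
        by simp
    qed
    then have "\<exists>\<^sub>F g in F. f g \<le> (y + Sup A) / 2"
      by (simp add: A_def not_eventually not_less)
    then show "\<exists>\<^sub>F g in F. f g < y"
      using y by (auto elim: frequently_elim1)
  qed
  moreover have "c \<le> Sup A"
    by (rule dense_le) (simp add: A_low bdd cSup_upper)
  moreover have "Sup A \<le> C"
    using A_up ne by (intro cSup_least)
  ultimately show ?thesis
    by auto
qed

lemma is_min_unique: "is_min S m \<Longrightarrow> is_min S m' \<Longrightarrow> m = m'"
  unfolding is_min_def by (meson order_antisym)

lemma SITBM_cong:
  assumes "\<And>g. g \<in> underS r t \<Longrightarrow> f g = f' g"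
  shows "SITBM r t f = SITBM r t f'"
proof -
  have "fin_limit_point r t f = fin_limit_point r t f'"
    "pinf_limit_point r t f = pinf_limit_point r t f'"
    "minf_limit_point r t f = minf_limit_point r t f'"
    "pinf_strong_limit_point r t f = pinf_strong_limit_point r t f'"
    "minf_strong_limit_point r t f = minf_strong_limit_point r t f'"
    unfolding fin_limit_point_def pinf_limit_point_def minf_limit_point_def 
      pinf_strong_limit_point_def minf_strong_limit_point_def fun_eq_iff
    by (simp_all add: assms cong: bex_cong ball_cong)
  then have "LimP r t f = LimP r t f'" "sLimP r t f = sLimP r t f'"
    unfolding LimP_def sLimP_def by simp_all
  then show ?thesis
    unfolding SITBM_def fun_eq_iff by simp
qed

context
  fixes r :: "'o rel" and t :: 'o
  assumes r: "Well_order r" and t: "limit_time r t"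
begin

lemma fin_limit_point_iff:
  "fin_limit_point r t f l \<longleftrightarrow> (\<forall>\<epsilon>>0. \<exists>\<^sub>F g in before r t. \<bar>f g - l\<bar> < \<epsilon>)"
  unfolding frequently_before[OF r t] fin_limit_point_def by blast

lemma pinf_limit_point_iff:
  "pinf_limit_point r t f \<longleftrightarrow> (\<forall>x. \<exists>\<^sub>F g in before r t. x < f g)"
  unfolding frequently_before[OF r t] pinf_limit_point_def by blast

lemma minf_limit_point_iff:
  "minf_limit_point r t f \<longleftrightarrow> (\<forall>x. \<exists>\<^sub>F g in before r t. f g < x)"
  unfolding frequently_before[OF r t] minf_limit_point_def by blast

lemma pinf_strong_limit_point_iff:
  "pinf_strong_limit_point r t f \<longleftrightarrow> (\<forall>x. \<forall>\<^sub>F g in before r t. x < f g)"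
  unfolding eventually_before[OF r t] pinf_strong_limit_point_def by blast

lemma minf_strong_limit_point_iff:
  "minf_strong_limit_point r t f \<longleftrightarrow> (\<forall>x. \<forall>\<^sub>F g in before r t. f g < x)"
  unfolding eventually_before[OF r t] minf_strong_limit_point_def by blast

lemmas limit_point_iffs =
  fin_limit_point_iff pinf_limit_point_iff minf_limit_point_iff
  pinf_strong_limit_point_iff minf_strong_limit_point_iff

lemma eventually_before_imp_frequently:
  "eventually Q (before r t) \<Longrightarrow> frequently Q (before r t)"
  by (rule eventually_frequently[OF before_neq_bot[OF r t]])

lemma eventually_frequently_ex:
  assumes "eventually Q (before r t)" "frequently Q' (before r t)"
  shows "\<exists>g. Q g \<and> Q' g"
  using frequently_eventually_frequently[OF assms(2,1)] by (auto dest: frequently_ex)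

lemma pinf_strong_LimP:
  assumes "pinf_strong_limit_point r t f"
  shows "LimP r t f = {\<infinity>}" "sLimP r t f = {\<infinity>}"
proof -
  have ev: "\<forall>\<^sub>F g in before r t. x < f g" for x
    using assms by (simp add: limit_point_iffs)
  have "\<not> fin_limit_point r t f l" for l
  proof
    assume "fin_limit_point r t f l"
    then have "\<exists>\<^sub>F g in before r t. \<bar>f g - l\<bar> < 1"
      by (simp add: limit_point_iffs)
    from eventually_frequently_ex[OF ev[of "l + 1"] this] show False
      by auto
  qed
  moreover have "\<not> minf_limit_point r t f"
  proof
    assume "minf_limit_point r t f"
    then have "\<exists>\<^sub>F g in before r t. f g < 0"
      by (simp add: limit_point_iffs)
    from eventually_frequently_ex[OF ev[of 0] this] show False
      by auto
  qed
  moreover have "pinf_limit_point r t f"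
    using eventually_before_imp_frequently[OF ev] by (simp add: limit_point_iffs)
  ultimately show "LimP r t f = {\<infinity>}" "sLimP r t f = {\<infinity>}"
    using assms by (auto simp: LimP_def sLimP_def minf_strong_limit_point_iff minf_limit_point_iff 
        eventually_before_imp_frequently)
qed

lemma minf_limit_is_min: "minf_limit_point r t f \<Longrightarrow> is_min (LimP r t f) (-\<infinity>)"
  by (auto simp: is_min_def LimP_def)

text \<open>Values close to v recur, whereas the values eventually exceed any given number below v.
  The latter rules out smaller finite limit points and -\<infinity>, strong or not.\<close>

lemma has_liminf_is_min:
  assumes v: "has_liminf (before r t) f v"
  shows "is_min (LimP r t f) (ereal v)" "is_min (sLimP r t f) (ereal v)"
proof -
  have "fin_limit_point r t f v"
    unfolding fin_limit_point_iff
  proof (intro allI impI)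
    fix \<epsilon> :: real assume "\<epsilon> > 0"
    then have "\<exists>\<^sub>F g in before r t. f g < v + \<epsilon> \<and> v - \<epsilon> < f g"
      by (intro frequently_eventually_frequently has_liminfD[OF v]) auto
    then show "\<exists>\<^sub>F g in before r t. \<bar>f g - v\<bar> < \<epsilon>"
      by (rule frequently_elim1) auto
  qed
  moreover have "v \<le> l" if "fin_limit_point r t f l" for l
  proof (rule ccontr)
    assume "\<not> v \<le> l"
    then have "\<forall>\<^sub>F g in before r t. (v + l) / 2 < f g"
      by (intro has_liminfD(1)[OF v]) simp
    moreover have "\<exists>\<^sub>F g in before r t. \<bar>f g - l\<bar> < (v - l) / 2"
      using that \<open>\<not> v \<le> l\<close> unfolding fin_limit_point_iff by (simp del: less_divide_eq_numeral1)
    ultimately obtain g where "(v + l) / 2 < f g" "\<bar>f g - l\<bar> < (v - l) / 2"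
      using eventually_frequently_ex by blast
    then show False
      using abs_ge_self[of "f g - l"] by (simp add: field_simps)
  qed
  moreover have minf: "\<not> minf_limit_point r t f"
  proof
    assume "minf_limit_point r t f"
    then have "\<exists>\<^sub>F g in before r t. f g < v - 1"
      by (simp add: minf_limit_point_iff)
    from eventually_frequently_ex[OF has_liminfD(1)[OF v, of "v - 1"] this] show False
      by auto
  qed
  moreover from minf have "\<not> minf_strong_limit_point r t f"
    unfolding limit_point_iffs using eventually_before_imp_frequently by blast
  ultimately show "is_min (LimP r t f) (ereal v)" "is_min (sLimP r t f) (ereal v)"
    by (auto simp: is_min_def LimP_def sLimP_def)
qed

lemma has_liminf_SITBM: "has_liminf (before r t) f v \<Longrightarrow> SITBM r t f v"
  using has_liminf_is_min unfolding SITBM_def by blast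

text \<open>Either the sequence tends to \<infinity> and the rule yields 0, which is above the bound
  because \<open>c \<le> 0\<close>, or it has a real limit inferior. This is what carries the
  scratch registers through limits.\<close>

lemma bounded_below_SITBM:
  assumes low: "\<forall>\<^sub>F g in before r t. c \<le> f g" and c: "c \<le> 0"
  shows "\<exists>v\<ge>c. SITBM r t f v"
proof (cases "pinf_strong_limit_point r t f")
  case True
  then show ?thesis
    using c pinf_strong_LimP(2)[OF True] unfolding SITBM_def is_min_def by auto
next
  case False
  then obtain C where "\<exists>\<^sub>F g in before r t. f g \<le> C"
    by (auto simp: pinf_strong_limit_point_iff not_eventually not_less)
  from has_liminf_exists[OF low this] show ?thesis
    using has_liminf_SITBM by auto
qed

text \<open>\<open>real_of_ereal\<close> sends both infinities to 0, the value that the rule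
  prescribes for them.\<close>

lemma SSITBM_is_min:
  assumes "SSITBM r t f v" "is_min (LimP r t f) m"
  shows "v = real_of_ereal m"
  using assms is_min_unique unfolding SSITBM_def by fastforce

text \<open>An infinite minimum of \<open>sLimP\<close> is a strong limit: \<infinity> is then the
  only limit point, and -\<infinity> is in particular an ordinary limit point, so the minimum of
  \<open>LimP\<close> is infinite as well. In the remaining case both rules ask for the real minimum
  of \<open>LimP\<close>.\<close>

lemma SITBM_imp_SSITBM:
  assumes "SITBM r t f v"
  shows "SSITBM r t f v"
proof (cases "is_min (sLimP r t f) \<infinity> \<or> is_min (sLimP r t f) (-\<infinity>)")
  case True
  then consider "pinf_strong_limit_point r t f" | "minf_strong_limit_point r t f"
    by (auto simp: is_min_def sLimP_def)
  then have "is_min (LimP r t f) \<infinity> \<or> is_min (LimP r t f) (-\<infinity>)"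
  proof cases
    case 1
    from pinf_strong_LimP(1)[OF this] show ?thesis
      by (simp add: is_min_def)
  next
    case 2
    then have "minf_limit_point r t f"
      by (simp add: limit_point_iffs eventually_before_imp_frequently)
    from minf_limit_is_min[OF this] show ?thesis ..
  qed
  moreover have "v = 0"
    using assms True is_min_unique[of "sLimP r t f"] unfolding SITBM_def by fastforce
  ultimately show ?thesis
    by (simp add: SSITBM_def)
next
  case False
  then show ?thesis
    using assms by (auto simp: SITBM_def SSITBM_def)
qed

end

lemma computation_SITBM_imp_SSITBM:
  "computation SITBM n P x r C \<Longrightarrow> computation SSITBM n P x r C"
  unfolding computation_def by (blast intro: SITBM_imp_SSITBM)

subsection \<open>Limits of the program counter\<close>

text \<open>For bounded naturals the infima and the supremum in \<open>liminf_pc\<close> are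
  attained, so the limit inferior is an eventual lower bound that is taken cofinally often.\<close>

lemma liminf_pc_spec:
  assumes r: "Well_order r" and t: "limit_time r t"
    and B: "\<And>g. g \<in> underS r t \<Longrightarrow> f g \<le> B"
  shows "\<forall>\<^sub>F g in before r t. liminf_pc r t f \<le> f g"
    and "\<exists>\<^sub>F g in before r t. f g = liminf_pc r t f"
proof -
  define A where "A b = f ` {g \<in> underS r t. (b, g) \<in> r}" for b
  define h where "h b = Inf (A b)" for b
  have mem: "h b \<in> A b" if "b \<in> underS r t" for b
  proof -
    have "b \<in> {g \<in> underS r t. (b, g) \<in> r}"
      using that underS_FieldD[OF that] r 
      by (auto simp: order_on_defs refl_on_def)
    then show ?thesis
      unfolding h_def A_def by (intro Inf_nat_def1) auto
  qed
  have "bdd_above (h ` underS r t)"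
    using mem B by (fastforce intro: bdd_aboveI[of _ B] simp: A_def)
  moreover have "h ` underS r t \<noteq> {}"
    using t by (auto simp: limit_time_def zero_time_def)
  ultimately have Sup: "Sup (h ` underS r t) \<in> h ` underS r t"
    "\<And>b. b \<in> underS r t \<Longrightarrow> h b \<le> Sup (h ` underS r t)"
    by (auto simp: cSup_eq_Max bdd_above_nat simp flip: image_is_empty intro: Max_in)
  have eq: "liminf_pc r t f = Sup (h ` underS r t)"
    unfolding liminf_pc_def h_def A_def ..
  obtain b where b: "b \<in> underS r t" "h b = liminf_pc r t f"
    using Sup(1) eq by auto
  have low: "liminf_pc r t f \<le> f g" if "g \<in> underS r t" "(b, g) \<in> r" for g
    unfolding b(2)[symmetric] h_def A_def using that by (intro cInf_lower) auto
  then show "\<forall>\<^sub>F g in before r t. liminf_pc r t f \<le> f g"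
    unfolding eventually_before[OF r t] using b(1) by (auto simp: underS_def)
  show "\<exists>\<^sub>F g in before r t. f g = liminf_pc r t f"
    unfolding frequently_before[OF r t]
  proof
    fix c assume c: "c \<in> underS r t"
    \<comment> \<open>Beyond both b and c, the attained infimum \<open>h d\<close> is squeezed: the
      choice of b bounds it from below, the supremum from above.\<close>
    obtain d where d: "d \<in> underS r t" "b \<in> underS r d" "c \<in> underS r d"
      using eventually_happens[OF eventually_conj[OF eventually_before_underS[OF r t] 
         eventually_conj[OF eventually_before_later[OF r t b(1)] eventually_before_later[OF r t c]]]]
         before_neq_bot[OF r t] by auto
    obtain g where g: "g \<in> underS r t" "(d, g) \<in> r" "f g = h d"
      using mem[OF d(1)] by (auto simp: A_def)
    have *: "b \<in> underS r g" "c \<in> underS r g"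
      using d g(2) underS_trans[OF r] unfolding underS_def by (cases "d = g"; blast)+
    then have "f g = liminf_pc r t f"
      using low[of g] g Sup(2)[OF d(1)] eq by (auto simp: underS_def)
    with g(1) * show "\<exists>g\<in>underS r t. c \<in> underS r g \<and> f g = liminf_pc r t f"
      by blast
  qed
qed

lemma liminf_pc_eqI:
  assumes r: "Well_order r" and t: "limit_time r t"
    and B: "\<And>g. g \<in> underS r t \<Longrightarrow> f g \<le> B"
    and low: "\<forall>\<^sub>F g in before r t. v \<le> f g" and up: "\<exists>\<^sub>F g in before r t. f g \<le> v"
  shows "liminf_pc r t f = v"
  using eventually_frequently_ex[OF r t liminf_pc_spec(1)[OF assms(1-3)] up]
    eventually_frequently_ex[OF r t low liminf_pc_spec(2)[OF assms(1-3)]]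
  by fastforce

lemma liminf_pc_cong:
  assumes "\<And>g. g \<in> underS r t \<Longrightarrow> f g = f' g"
  shows "liminf_pc r t f = liminf_pc r t f'"
proof -
  have "f ` {g \<in> underS r t. (b, g) \<in> r} = f' ` {g \<in> underS r t. (b, g) \<in> r}" for b
    using assms by (intro image_cong) auto
  then show ?thesis
    by (simp add: liminf_pc_def)
qed

subsection \<open>Compressing the reals\<close>

definition enc :: "real \<Rightarrow> real" where
  "enc x = x / (1 + \<bar>x\<bar>)"

text \<open>
  At the limits \<open>-1\<close> and \<open>1\<close> of \<open>enc\<close> the junk value \<open>s / 0 = 0\<close> is the value prescribed by
  \<open>SSITBM\<close> for an infinite limit inferior.
\<close>

definition dec :: "real \<Rightarrow> real" where
  "dec s = s / (1 - \<bar>s\<bar>)"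

lemma abs_enc_less: "\<bar>enc x\<bar> < 1"
  by (simp add: enc_def)

lemma dec_enc [simp]: "dec (enc x) = x"
proof -
  have "1 + \<bar>x\<bar> \<noteq> 0"
    by linarith
  then show ?thesis
    by (simp add: enc_def dec_def field_simps)
qed

lemma enc_dec: "\<bar>s\<bar> < 1 \<Longrightarrow> enc (dec s) = s"
  by (simp add: enc_def dec_def abs_divide field_simps)

lemma enc_0 [simp]: "enc 0 = 0"
  by (simp add: enc_def)

lemma enc_mult: "enc x * (1 + \<bar>x\<bar>) = x"
proof -
  have "1 + \<bar>x\<bar> \<noteq> 0"
    by linarith
  then show ?thesis
    by (simp add: enc_def)
qed

lemma enc_pos_iff: "0 < enc x \<longleftrightarrow> 0 < x"
  by (auto simp: enc_def zero_less_divide_iff)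

lemma enc_strict_mono: "x < y \<Longrightarrow> enc x < enc y"
proof -
  assume xy: "x < y"
  \<comment> \<open>Equality holds for equal signs; otherwise x is negative and y is not, so 0
    separates the two sides.\<close>
  have "x * \<bar>y\<bar> \<le> y * \<bar>x\<bar>"
    using xy by (cases "x \<ge> 0"; cases "y \<ge> 0") (auto simp: mult_le_0_iff zero_le_mult_iff intro: order_trans[of _ 0])
  then have "x * (1 + \<bar>y\<bar>) < y * (1 + \<bar>x\<bar>)"
    using xy by (simp add: algebra_simps)
  moreover have "0 < 1 + \<bar>x\<bar>" "0 < 1 + \<bar>y\<bar>"
    by linarith+
  ultimately show ?thesis
    by (simp add: enc_def pos_divide_less_eq pos_less_divide_eq)
qed

lemma enc_less_iff: "enc x < enc y \<longleftrightarrow> x < y"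
  using enc_strict_mono by (metis linorder_neqE_linordered_idom order_less_asym)

lemma has_liminf_enc_exists:
  assumes r: "Well_order r" and t: "limit_time r t"
  shows "\<exists>\<sigma>. \<bar>\<sigma>\<bar> \<le> 1 \<and> has_liminf (before r t) (\<lambda>s. enc (f s)) \<sigma>"
proof -
  have *: "-1 \<le> enc x" "enc x \<le> 1" for x
    using abs_enc_less[of x] by auto
  have "\<exists>\<sigma>\<in>{-1..1}. has_liminf (before r t) (\<lambda>s. enc (f s)) \<sigma>"
    by (intro has_liminf_exists) (simp_all add: * before_neq_bot[OF r t])
  then show ?thesis
    by (auto simp: abs_le_iff)
qed

text \<open>Inside (-1, 1) the order isomorphism transports the limit inferior. The value 1 means
  that f tends to \<infinity>, and -1 that f is unbounded below before t; in both cases the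
  prescribed value is 0, as is that of \<open>dec\<close>.\<close>

lemma SSITBM_eq_dec:
  assumes r: "Well_order r" and t: "limit_time r t"
    and \<sigma>: "\<bar>\<sigma>\<bar> \<le> 1" "has_liminf (before r t) (\<lambda>s. enc (f s)) \<sigma>"
    and v: "SSITBM r t f v"
  shows "v = dec \<sigma>"
proof -
  note D = has_liminfD[OF \<sigma>(2)]
  consider "\<bar>\<sigma>\<bar> < 1" | "\<sigma> = 1" | "\<sigma> = -1"
    using \<sigma>(1) by linarith
  then show ?thesis
  proof cases
    case 1
    have "has_liminf (before r t) f (dec \<sigma>)"
    proof (rule has_liminfI)
      fix y assume "y < dec \<sigma>"
      then have "enc y < \<sigma>"
        using enc_less_iff[of y "dec \<sigma>"] enc_dec[OF 1] by simp
      from D(1)[OF this] show "\<forall>\<^sub>F g in before r t. y < f g"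
        by (simp add: enc_less_iff)
    next
      fix y assume "dec \<sigma> < y"
      then have "\<sigma> < enc y"
        using enc_less_iff[of "dec \<sigma>" y] enc_dec[OF 1] by simp
      from D(2)[OF this] show "\<exists>\<^sub>F g in before r t. f g < y"
        by (simp add: enc_less_iff)
    qed
    from SSITBM_is_min[OF r t v has_liminf_is_min(1)[OF r t this]] show ?thesis
      by simp
  next
    case 2
    have "pinf_strong_limit_point r t f"
      unfolding pinf_strong_limit_point_iff[OF r t]
    proof
      fix x
      have "enc x < \<sigma>"
        using abs_enc_less[of x] 2 by simp
      from D(1)[OF this] show "\<forall>\<^sub>F g in before r t. x < f g"
        by (simp add: enc_less_iff)
    qed
    from pinf_strong_LimP(1)[OF r t this] have "is_min (LimP r t f) \<infinity>"
      by (simp add: is_min_def)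
    from SSITBM_is_min[OF r t v this] show ?thesis
      using 2 by (simp add: dec_def)
  next
    case 3
    have "minf_limit_point r t f"
      unfolding minf_limit_point_iff[OF r t]
    proof
      fix x
      have "\<sigma> < enc x"
        using abs_enc_less[of x] 3 by simp
      from D(2)[OF this] show "\<exists>\<^sub>F g in before r t. f g < x"
        by (simp add: enc_less_iff)
    qed
    from SSITBM_is_min[OF r t v minf_limit_is_min[OF r t this]] show ?thesis
      using 3 by (simp add: dec_def)
  qed
qed

subsection \<open>Gadgets\<close>

lemma poly_val_cong: "(\<And>v. v \<in> vars p \<Longrightarrow> \<rho> v = \<rho>' v) \<Longrightarrow> poly_val p \<rho> = poly_val p \<rho>'"
  by (induction p) auto

text \<open>
  The gadget \<open>(v, i, p, q)\<close> performs \<open>R_i := p/q\<close> unless \<open>R_v > 0\<close>. It takes exactly two steps in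
  either case, so that the time needed to simulate one step does not depend on the data.
\<close>

type_synonym gadget = "nat \<times> nat \<times> nat rat_poly \<times> nat rat_poly"

fun apply_gadget :: "gadget \<Rightarrow> (nat \<Rightarrow> real) \<Rightarrow> nat \<Rightarrow> real" where
  "apply_gadget (v, i, p, q) R = (if R v > 0 then R else R(i := poly_val p R / poly_val q R))"

fun gadget_ok :: "gadget \<Rightarrow> (nat \<Rightarrow> real) \<Rightarrow> bool" where
  "gadget_ok (v, i, p, q) R \<longleftrightarrow> R v > 0 \<or> poly_val q R \<noteq> 0"

fun gadget_line :: "nat \<Rightarrow> gadget \<Rightarrow> nat \<Rightarrow> instr" where
  "gadget_line l (v, i, p, q) d =
     (if d = 0 then Branch v (l + 1) (l + 2)
      else if d = 1 then Branch v (l + 3) (l + 3) else Assign i p q)"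

fun wf_gadget :: "nat \<Rightarrow> gadget \<Rightarrow> bool" where
  "wf_gadget n (v, i, p, q) \<longleftrightarrow> v \<in> {1..n} \<and> wf_instr n (Assign i p q)"

text \<open>A total function, so that it can be iterated with \<open>^^\<close>. It is meaningful
  only where \<open>step\<close> is defined, which is proved separately for every step used.\<close>

definition nxt :: "program \<Rightarrow> snapshot \<Rightarrow> snapshot" where
  "nxt P c = the (step P c)"

abbreviation regs :: "gadget list \<Rightarrow> (nat \<Rightarrow> real) \<Rightarrow> nat \<Rightarrow> nat \<Rightarrow> real" where
  "regs gs R j \<equiv> fold apply_gadget (take j gs) R"

lemma gadget_run:
  assumes len: "l + 2 < length P"
    and line: "\<And>d. d < 3 \<Longrightarrow> P ! (l + d) = gadget_line l g d" and ok: "gadget_ok g R"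
  shows "\<exists>l'\<in>{l..l+2}. step P (R, l) = Some (R, l') \<and> step P (R, l') = Some (apply_gadget g R, l + 3)"
proof -
  obtain v i p q where g: "g = (v, i, p, q)"
    by (cases g)
  have "P ! l = Branch v (l + 1) (l + 2)" "P ! Suc l = Branch v (l + 3) (l + 3)"
    "P ! Suc (Suc l) = Assign i p q"
    using line[of 0] line[of 1] line[of 2] by (simp_all add: g numeral_2_eq_2)
  then show ?thesis
    using len ok
    by (intro bexI[of _ "if R v > 0 then l + 1 else l + 2"])
      (auto simp: g step_def halted_def numeral_2_eq_2 numeral_3_eq_3)
qed

text \<open>N blocks, each of G gadgets of three lines followed by one jump. The equal length makes
  block addresses multiples of 3 G + 1, and \<open>div\<close> and \<open>mod\<close> recover the
  position of a line.\<close>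

definition assemble :: "nat \<Rightarrow> nat \<Rightarrow> (nat \<Rightarrow> gadget list) \<Rightarrow> (nat \<Rightarrow> instr) \<Rightarrow> program" where
  "assemble G N gs br = map (\<lambda>l.
     let b = l div (3 * G + 1); c = l mod (3 * G + 1) in
     if c = 3 * G then br b
     else gadget_line (b * (3 * G + 1) + 3 * (c div 3)) (gs b ! (c div 3)) (c mod 3))
   [0..<N * (3 * G + 1)]"

lemma length_assemble: "length (assemble G N gs br) = N * (3 * G + 1)"
  by (simp add: assemble_def)

lemma block_line_less:
  assumes "b < N" "c < L"
  shows "b * L + c < N * (L :: nat)"
proof -
  have "b * L + c < (b + 1) * L"
    using assms by simp
  also have "\<dots> \<le> N * L"
    using assms by (intro mult_right_mono) auto
  finally show ?thesis .
qed

lemma assemble_nth: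
  assumes b: "b < N"
  shows "assemble G N gs br ! (b * (3 * G + 1) + 3 * G) = br b"
    and "g < G \<Longrightarrow> d < 3 \<Longrightarrow> assemble G N gs br ! (b * (3 * G + 1) + 3 * g + d) =
      gadget_line (b * (3 * G + 1) + 3 * g) (gs b ! g) d"
proof -
  have *: "assemble G N gs br ! (b * (3 * G + 1) + c) =
     (if c = 3 * G then br b
      else gadget_line (b * (3 * G + 1) + 3 * (c div 3)) (gs b ! (c div 3)) (c mod 3))"
    if "c < 3 * G + 1" for c
  proof -
    define L where "L = 3 * G + 1"
    have "(b * L + c) div L = b" "(b * L + c) mod L = c" "b * L + c < N * L"
      using that[folded L_def] block_line_less[OF b, of c L] by simp_all
    then show ?thesis
      unfolding assemble_def L_def[symmetric] by (subst nth_map_upt) (simp_all add: Let_def)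
  qed
  show "assemble G N gs br ! (b * (3 * G + 1) + 3 * G) = br b"
    by (subst *) auto
  assume "g < G" "d < 3"
  then have "3 * g + d < 3 * G + 1" "3 * g + d \<noteq> 3 * G" "(3 * g + d) div 3 = g"
    "(3 * g + d) mod 3 = d"
    by auto
  then show "assemble G N gs br ! (b * (3 * G + 1) + 3 * g + d) =
      gadget_line (b * (3 * G + 1) + 3 * g) (gs b ! g) d"
    unfolding add.assoc by (subst *) auto
qed

lemma set_assemble:
  assumes len: "\<And>b. b < N \<Longrightarrow> length (gs b) = G"
    and gad: "\<And>b g. b < N \<Longrightarrow> g \<in> set (gs b) \<Longrightarrow> wf_gadget n g"
    and br: "\<And>b. b < N \<Longrightarrow> wf_instr n (br b)"
    and c: "c \<in> set (assemble G N gs br)"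
  shows "wf_instr n c"
proof -
  obtain l where l: "l < N * (3 * G + 1)" and c: "c = assemble G N gs br ! l"
    using c by (auto simp: in_set_conv_nth length_assemble)
  define b where "b = l div (3 * G + 1)"
  define e where "e = l mod (3 * G + 1)"
  have b: "b < N" and e: "e < 3 * G + 1"
    using l by (simp_all add: b_def e_def less_mult_imp_div_less)
  have le: "l = b * (3 * G + 1) + e"
    unfolding b_def e_def by (simp only: div_mult_mod_eq)
  show ?thesis
  proof (cases "e = 3 * G")
    case True
    then show ?thesis
      using assemble_nth(1)[OF b] br[OF b] by (simp add: c le)
  next
    case False
    then have d: "e div 3 < G" "e = 3 * (e div 3) + e mod 3"
      using e by auto
    have "wf_gadget n (gs b ! (e div 3))"
      using gad[OF b] len[OF b] d(1) by simp
    moreover have "c = gadget_line (b * (3 * G + 1) + 3 * (e div 3)) (gs b ! (e div 3)) (e mod 3)"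
      unfolding c le using assemble_nth(2)[OF b d(1), of "e mod 3" gs br] by (simp add: add.assoc)
    moreover have "wf_instr n (gadget_line k g d)" if "wf_gadget n g" for k g d
      using that by (cases g) auto
    ultimately show ?thesis
      by blast
  qed
qed

context
  fixes G N b :: nat and gs :: "nat \<Rightarrow> gadget list" and br :: "nat \<Rightarrow> instr" and R :: "nat \<Rightarrow> real"
    and P :: program and L :: nat
  assumes b: "b < N" and len: "length (gs b) = G"
    and ok: "\<And>g. g < G \<Longrightarrow> gadget_ok (gs b ! g) (regs (gs b) R g)"
  defines "P \<equiv> assemble G N gs br" and "L \<equiv> 3 * G + 1"
begin

lemma block_run_gadget:
  assumes "g < G"
  shows "\<exists>l'\<in>{b*L+3*g..b*L+3*g+2}.
    step P (regs (gs b) R g, b * L + 3 * g) = Some (regs (gs b) R g, l') \<and>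
    step P (regs (gs b) R g, l') = Some (regs (gs b) R (Suc g), b * L + 3 * Suc g)"
proof -
  have "b * L + (3 * g + 2) < N * L"
    using assms by (intro block_line_less b) (simp add: L_def)
  then have "b * L + 3 * g + 2 < length P"
    by (simp add: P_def length_assemble L_def)
  from gadget_run[OF this _ ok[OF assms]] show ?thesis
    using assemble_nth(2)[OF b assms, of _ gs br] assms len
    by (simp add: P_def L_def take_Suc_conv_app_nth algebra_simps)
qed

lemma block_run_even:
  "g \<le> G \<Longrightarrow> (nxt P ^^ (2 * g)) (R, b * L) = (regs (gs b) R g, b * L + 3 * g)"
proof (induction g)
  case (Suc g)
  then have "(nxt P ^^ (2 * g)) (R, b * L) = (regs (gs b) R g, b * L + 3 * g)"
    by simp
  moreover from Suc.prems obtain l' where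
    "step P (regs (gs b) R g, b * L + 3 * g) = Some (regs (gs b) R g, l')"
    "step P (regs (gs b) R g, l') = Some (regs (gs b) R (Suc g), b * L + 3 * Suc g)"
    using block_run_gadget[of g] by auto
  then have "nxt P (regs (gs b) R g, b * L + 3 * g) = (regs (gs b) R g, l')"
    "nxt P (regs (gs b) R g, l') = (regs (gs b) R (Suc g), b * L + 3 * Suc g)"
    by (simp_all add: nxt_def)
  ultimately show ?case
    by simp
qed simp

text \<open>After an even number of steps the control is at the start of a gadget or at the final
  jump; after an odd number it is inside a gadget that has not yet changed any register. Hence only
  results of whole gadgets are ever visible.\<close>

lemma block_run:
  assumes "k < 2 * G + 1" and br: "br b = Branch i a a'"
  defines "c \<equiv> (nxt P ^^ k) (R, b * L)"
  shows "\<exists>j\<le>G. fst c = regs (gs b) R j" "snd c \<in> {b * L..<b * L + L}"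
    "step P c = Some ((nxt P ^^ Suc k) (R, b * L))"
    "(nxt P ^^ (2 * G + 1)) (R, b * L) =
      (regs (gs b) R G, if regs (gs b) R G i > 0 then a else a')"
proof -
  have "b * L + 3 * G < N * L"
    by (intro block_line_less b) (simp add: L_def)
  then have brs: "step P (X, b * L + 3 * G) = Some (X, if X i > 0 then a else a')" for X
    using assemble_nth(1)[OF b, of G gs br] br
    by (simp add: step_def halted_def P_def length_assemble L_def)
  show "(nxt P ^^ (2 * G + 1)) (R, b * L) =
      (regs (gs b) R G, if regs (gs b) R G i > 0 then a else a')"
    by (simp add: block_run_even brs nxt_def)
  have "(\<exists>j\<le>G. fst c = regs (gs b) R j) \<and> snd c \<in> {b * L..<b * L + L} \<and> step P c \<noteq> None"
  proof (cases "even k")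
    case True
    then obtain j where k: "k = 2 * j"
      by (elim evenE)
    then have j: "j \<le> G" and c: "c = (regs (gs b) R j, b * L + 3 * j)"
      using assms(1) by (simp_all add: c_def block_run_even)
    show ?thesis
    proof (cases "j = G")
      case True
      then show ?thesis
        using brs by (auto simp: c L_def)
    next
      case False
      then have "j < G"
        using j by simp
      from block_run_gadget[OF this] show ?thesis
        using \<open>j < G\<close> by (auto simp: c L_def intro: exI[of _ j])
    qed
  next
    case False
    then obtain j where k: "k = Suc (2 * j)"
      by (auto elim: oddE)
    then have j: "j < G"
      using assms(1) by simp
    obtain l' where l': "l' \<in> {b*L+3*j..b*L+3*j+2}"
      "step P (regs (gs b) R j, b * L + 3 * j) = Some (regs (gs b) R j, l')"
      "step P (regs (gs b) R j, l') = Some (regs (gs b) R (Suc j), b * L + 3 * Suc j)"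
      using block_run_gadget[OF j] by blast
    then have "c = (regs (gs b) R j, l')"
      using j by (simp add: c_def k block_run_even nxt_def)
    then show ?thesis
      using l' j by (auto simp: L_def intro: exI[of _ j])
  qed
  then show "\<exists>j\<le>G. fst c = regs (gs b) R j" "snd c \<in> {b * L..<b * L + L}"
    "step P c = Some ((nxt P ^^ Suc k) (R, b * L))"
    by (auto simp: c_def nxt_def)
qed

end

text \<open>Q is demanded of every intermediate content and not just of the last, because later
  limits see all of them.\<close>

fun along :: "((nat \<Rightarrow> real) \<Rightarrow> bool) \<Rightarrow> gadget list \<Rightarrow> (nat \<Rightarrow> real) \<Rightarrow> bool" where
  "along Q [] R \<longleftrightarrow> Q R"
| "along Q (g # gs) R \<longleftrightarrow> Q R \<and> gadget_ok g R \<and> along Q gs (apply_gadget g R)"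

lemma along_append:
  "along Q (gs @ gs') R \<longleftrightarrow> along Q gs R \<and> along Q gs' (fold apply_gadget gs R)"
  by (induction gs arbitrary: R) (auto elim: along.elims)

lemma along_regs: "along Q gs R \<Longrightarrow> Q (regs gs R j)"
proof (induction gs arbitrary: R j)
  case (Cons g gs)
  then show ?case
    by (cases j) auto
qed simp

lemma along_fold: "along Q gs R \<Longrightarrow> Q (fold apply_gadget gs R)"
  using along_regs[of Q gs R "length gs"] by simp

lemma along_ok: "along Q gs R \<Longrightarrow> g < length gs \<Longrightarrow> gadget_ok (gs ! g) (regs gs R g)"
proof (induction gs arbitrary: R g)
  case (Cons a gs)
  then show ?case
    by (cases g) auto
qed simp

subsection \<open>The simulating program\<close>

text \<open>
  Register \<open>R_j\<close> of the simulated machine is represented by \<open>S_j = enc R_j\<close>, kept in register \<open>j\<close>.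
  Register \<open>n + j\<close> holds \<open>1 + \<bar>R_j\<bar>\<close> after decoding, so that \<open>R_j\<close> itself, which may be unbounded
  below, is never stored. Register \<open>2n + 1\<close> is for auxiliary values, and register \<open>2n + 2\<close>
  is always \<open>0\<close>.
\<close>

definition decode :: "nat \<Rightarrow> nat \<Rightarrow> gadget list" where
  "decode n j =
    [(2 * n + 2, 2 * n + 1, Mul (Const (-1)) (Var j), Const 1),
     (2 * n + 1, 2 * n + 1, Var j, Const 1),
     (2 * n + 2, n + j, Add (Const 1) (Mul (Const (-1)) (Var (2 * n + 1))), Const 1),
     (n + j, j, Const 0, Const 1),
     (n + j, n + j, Const 1, Const 1),
     (2 * n + 2, n + j, Const 1, Var (n + j))]"

text \<open>
  The first gadget computes a number of the same sign as \<open>p/q\<close>, the next three turn it into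
  \<open>-1\<close> if \<open>p/q > 0\<close> and into \<open>1\<close> otherwise.
\<close>

definition encode :: "nat \<Rightarrow> nat \<Rightarrow> nat rat_poly \<Rightarrow> nat rat_poly \<Rightarrow> gadget list" where
  "encode n i p q =
    [(2 * n + 2, 2 * n + 1, Mul p q, Add (Mul p p) (Mul q q)),
     (2 * n + 1, 2 * n + 1, Const (-1), Const 1),
     (2 * n + 2, 2 * n + 1, Mul (Const (-1)) (Var (2 * n + 1)), Const 1),
     (2 * n + 1, 2 * n + 1, Const (-1), Const 1),
     (2 * n + 2, i, p, Add q (Mul (Const (-1)) (Mul (Var (2 * n + 1)) p)))]"

definition decode_upto :: "nat \<Rightarrow> nat \<Rightarrow> gadget list" where
  "decode_upto n k = concat (map (decode n) [1..<Suc k])"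

text \<open>Idle gadgets that give all blocks the same length and running time.\<close>

definition padding :: "nat \<Rightarrow> nat \<Rightarrow> gadget list" where
  "padding n k = replicate k (2 * n + 2, 2 * n + 1, Const 0, Const 1)"

text \<open>Substitutes for each variable the product of its code and its scaling register, which by
  \<open>enc_mult\<close> is the decoded content.\<close>

primrec unfold_poly :: "nat \<Rightarrow> nat rat_poly \<Rightarrow> nat rat_poly" where
  "unfold_poly n (Const c) = Const c"
| "unfold_poly n (Var v) = Mul (Var v) (Var (n + v))"
| "unfold_poly n (Add p q) = Add (unfold_poly n p) (unfold_poly n q)"
| "unfold_poly n (Mul p q) = Mul (unfold_poly n p) (unfold_poly n q)"

lemma length_gadgets:
  "length (encode n i p q) = 5" "length (decode_upto n k) = 6 * k" "length (padding n k) = k"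
  by (induction k) (simp_all add: encode_def decode_upto_def padding_def decode_def)

lemma poly_val_unfold_poly: "poly_val (unfold_poly n p) X = poly_val p (\<lambda>v. X v * X (n + v))"
  by (induction p) auto

lemma vars_unfold_poly: "vars p \<subseteq> {1..n} \<Longrightarrow> vars (unfold_poly n p) \<subseteq> {1..2 * n}"
  by (induction p) auto

text \<open>
  The limits of the registers \<open>1..n\<close> have to be known exactly, so their values are restricted to
  given sets. For the auxiliary registers a lower bound suffices, as \<open>SITBM\<close> is defined on every
  sequence that is bounded below.
\<close>

definition safe :: "nat \<Rightarrow> (nat \<Rightarrow> real set) \<Rightarrow> (nat \<Rightarrow> real) \<Rightarrow> bool" where
  "safe n A X \<longleftrightarrow> (\<forall>j\<in>{1..n}. X j \<in> A j \<and> 0 \<le> X (n + j)) \<and> -1 \<le> X (2 * n + 1) \<and> X (2 * n + 2) = 0"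

section \<open>Effect of the gadget lists\<close>

lemma safe_upd:
  assumes "safe n A X"
  shows "j \<in> {1..n} \<Longrightarrow> v \<in> A j \<Longrightarrow> safe n A (X(j := v))"
    and "j \<in> {1..n} \<Longrightarrow> 0 \<le> v \<Longrightarrow> safe n A (X(n + j := v))"
    and "-1 \<le> v \<Longrightarrow> safe n A (X(Suc (2 * n) := v))"
  using assms by (auto simp: safe_def)

lemma safe_zero: "safe n A X \<Longrightarrow> X (Suc (Suc (2 * n))) = 0"
  by (simp add: safe_def)

lemma safe_mono: "safe n A X \<Longrightarrow> (\<And>j. j \<in> {1..n} \<Longrightarrow> A j \<subseteq> B j) \<Longrightarrow> safe n B X"
  unfolding safe_def by blast

text \<open>The first two gadgets leave \<bar>S_j\<bar> in register 2n + 1, passing through -S_j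
  \<ge> -1; the third puts 1 - \<bar>S_j\<bar> into register n + j. This is 0 exactly for the limit
  values -1 and 1, and then the guards of the next two gadgets let them reset S_j to 0 and, only
  afterwards, register n + j to 1. The last gadget inverts register n + j, which is now positive.
  Register j takes no value besides the old and the reset one.\<close>

lemma decode_along:
  assumes X: "safe n A X" and j: "j \<in> {1..n}" and le: "\<bar>X j\<bar> \<le> 1" and A: "enc (dec (X j)) \<in> A j"
  shows "along (safe n A) (decode n j) X"
    and "fold apply_gadget (decode n j) X =
      X(2 * n + 1 := \<bar>X j\<bar>, j := enc (dec (X j)), n + j := 1 + \<bar>dec (X j)\<bar>)"
proof -
  have idx: "j \<noteq> n + j" "j \<noteq> Suc (2 * n)" "j \<noteq> Suc (Suc (2 * n))" "n + j \<noteq> Suc (2 * n)"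
     "n + j \<noteq> Suc (Suc (2 * n))"
    using j by auto
  have Xj: "X j \<in> A j"
    using X j by (simp add: safe_def)
  consider (1) "X j = 1" | (2) "X j = -1" | (3) "0 < X j" "X j < 1" | (4) "-1 < X j" "X j \<le> 0"
    using le by linarith
  then have "along (safe n A) (decode n j) X \<and> fold apply_gadget (decode n j) X =
      X(2 * n + 1 := \<bar>X j\<bar>, j := enc (dec (X j)), n + j := 1 + \<bar>dec (X j)\<bar>)"
  proof cases
    case 1
    then have d: "dec (X j) = 0"
      by (simp add: dec_def)
    have "0 \<in> A j"
      using A by (simp add: d)
    then show ?thesis
      using X j 1 Xj idx by (simp add: decode_def safe_upd safe_zero dec_def fun_upd_twist)
  next
    case 2
    then have d: "dec (X j) = 0"
      by (simp add: dec_def)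
    have "0 \<in> A j"
      using A by (simp add: d)
    then show ?thesis
      using X j 2 Xj idx by (simp add: decode_def safe_upd safe_zero dec_def fun_upd_twist)
  next
    case 3
    have "1 + \<bar>dec (X j)\<bar> = 1 / (1 - X j)" "enc (dec (X j)) = X j"
      using 3 by (simp_all add: enc_dec) (simp add: dec_def field_simps)
    then show ?thesis
      using X j 3 Xj idx by (simp add: decode_def safe_upd safe_zero fun_upd_twist)
  next
    case 4
    have "1 + \<bar>dec (X j)\<bar> = 1 / (1 + X j)" "enc (dec (X j)) = X j"
      using 4 by (simp_all add: enc_dec) (simp add: dec_def field_simps)
    then show ?thesis
      using X j 4 Xj idx
      by (cases "X j = 0") (simp_all add: decode_def safe_upd safe_zero fun_upd_twist fun_upd_idem)
  qed
  then show "along (safe n A) (decode n j) X"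
    "fold apply_gadget (decode n j) X =
      X(2 * n + 1 := \<bar>X j\<bar>, j := enc (dec (X j)), n + j := 1 + \<bar>dec (X j)\<bar>)"
    by blast+
qed

lemma decode_upto_along:
  assumes X: "safe n A X" and le: "\<And>j. j \<in> {1..n} \<Longrightarrow> \<bar>X j\<bar> \<le> 1 \<and> enc (dec (X j)) \<in> A j"
    and k: "k \<le> n"
  defines "Y \<equiv> fold apply_gadget (decode_upto n k) X"
  shows "along (safe n A) (decode_upto n k) X \<and>
    (\<forall>j\<in>{1..k}. Y j = enc (dec (X j)) \<and> Y (n + j) = 1 + \<bar>dec (X j)\<bar>) \<and>
    (\<forall>j\<in>{k<..n}. Y j = X j)"
  using k unfolding Y_def
proof (induction k)
  case 0
  then show ?case
    using X by (simp add: decode_upto_def)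
next
  case (Suc k)
  define Z where "Z = fold apply_gadget (decode_upto n k) X"
  have IH: "along (safe n A) (decode_upto n k) X"
    "\<And>j. j \<in> {1..k} \<Longrightarrow> Z j = enc (dec (X j)) \<and> Z (n + j) = 1 + \<bar>dec (X j)\<bar>"
    "\<And>j. j \<in> {k<..n} \<Longrightarrow> Z j = X j"
    using Suc unfolding Z_def by auto
  have eq: "decode_upto n (Suc k) = decode_upto n k @ decode n (Suc k)"
    by (simp add: decode_upto_def)
  have Zk: "Z (Suc k) = X (Suc k)" and sk: "Suc k \<in> {1..n}"
    using IH(3) Suc.prems by auto
  have Z: "safe n A Z"
    unfolding Z_def by (rule along_fold[OF IH(1)])
  note D = decode_along[OF Z sk, unfolded Zk, OF conjunct1[OF le[OF sk]] conjunct2[OF le[OF sk]]]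
  show ?case
    unfolding eq along_append fold_append comp_def Z_def[symmetric] D(2)
    using D(1) IH sk by (auto simp: le_Suc_eq Z_def)
qed

text \<open>With the sign prepared in register 2n + 1, the last gadget writes p / (q + p) if p / q
  is positive and p / (q - p) otherwise. Either is \<open>enc\<close> of p / q, so the quotient
  itself is never stored. The denominator cannot vanish because q + p or q - p is q times a number
  that is at least 1.\<close>

lemma encode_along:
  assumes X: "safe n A X" and i: "i \<in> {1..n}"
    and M: "2 * n + 1 \<notin> vars p" "2 * n + 1 \<notin> vars q"
    and q: "poly_val q X \<noteq> 0" and A: "enc (poly_val p X / poly_val q X) \<in> A i"
  shows "along (safe n A) (encode n i p q) X"
    and "fold apply_gadget (encode n i p q) X i = enc (poly_val p X / poly_val q X)"
    and "j \<noteq> i \<Longrightarrow> j \<noteq> 2 * n + 1 \<Longrightarrow> fold apply_gadget (encode n i p q) X j = X j"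
proof -
  define a b where "a = poly_val p X" and "b = poly_val q X"
  have pq: "poly_val p (X(Suc (2 * n) := v)) = a" "poly_val q (X(Suc (2 * n) := v)) = b" for v
    using M unfolding a_def b_def by (auto intro!: poly_val_cong)
  have idx: "i \<noteq> Suc (2 * n)" "i \<noteq> Suc (Suc (2 * n))"
    using i by auto
  have b: "b \<noteq> 0" and A: "enc (a / b) \<in> A i"
    using q A by (simp_all add: a_def b_def)
  \<comment> \<open>This has the sign of a / b and stays in [-1, 1]. The product
    \<open>a * b\<close> has the same sign but might be unbounded below over time, which could crash
    a later limit.\<close>
  define m where "m = a * b / (a * a + b * b)"
  have pos: "0 < a * a + b * b"
    using b by (simp add: sum_squares_gt_zero_iff)
  have "0 \<le> (a + b) * (a + b)" "0 \<le> (a - b) * (a - b)"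
    by simp_all
  then have "- (a * a + b * b) \<le> a * b" "a * b \<le> a * a + b * b"
    using zero_le_square[of a] zero_le_square[of b] by (simp_all add: algebra_simps)
  then have m: "-1 \<le> m" "m \<le> 1"
    using pos by (simp_all add: m_def pos_le_divide_eq pos_divide_le_eq)
  have sgn: "0 < m \<longleftrightarrow> 0 < a / b"
    using pos by (simp add: m_def zero_less_divide_iff zero_less_mult_iff)
  have *: "along (safe n A) (encode n i p q) X \<and> fold apply_gadget (encode n i p q) X =
    X(2 * n + 1 := (if 0 < m then -1 else 1), i := enc (a / b))"
  proof (cases "0 < m")
    case True
    then have pos': "0 < a / b"
      by (simp add: sgn)
    have "b + a \<noteq> 0"
      using pos' by (auto simp: zero_less_divide_iff)
    moreover have "enc (a / b) = (a / b) / (1 + a / b)"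
      using pos' by (simp only: enc_def abs_of_pos)
    then have "enc (a / b) = a / (b + a)"
      using b \<open>b + a \<noteq> 0\<close> by (simp add: field_simps)
    ultimately show ?thesis
      using X i A True idx b pos m
      by (simp add: encode_def safe_upd safe_zero pq m_def[symmetric] a_def[symmetric] b_def[symmetric])
  next
    case False
    then have neg: "a / b \<le> 0"
      by (simp add: sgn)
    have "b - a \<noteq> 0"
      using neg b by auto
    moreover have "enc (a / b) = (a / b) / (1 + - (a / b))"
      using neg by (simp only: enc_def abs_of_nonpos)
    then have "enc (a / b) = a / (b - a)"
      using b \<open>b - a \<noteq> 0\<close> by (simp add: field_simps)
    ultimately show ?thesis
      using X i A False idx b pos m
      by (simp add: encode_def safe_upd safe_zero pq m_def[symmetric] a_def[symmetric] b_def[symmetric])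
  qed
  then show "along (safe n A) (encode n i p q) X"
    "fold apply_gadget (encode n i p q) X i = enc (poly_val p X / poly_val q X)"
    "j \<noteq> i \<Longrightarrow> j \<noteq> 2 * n + 1 \<Longrightarrow> fold apply_gadget (encode n i p q) X j = X j"
    by (simp_all add: a_def b_def)
qed

lemma padding_along:
  assumes X: "safe n A X"
  shows "along (safe n A) (padding n k) X"
    and "j \<noteq> 2 * n + 1 \<Longrightarrow> fold apply_gadget (padding n k) X j = X j"
proof -
  have "along (safe n A) (padding n k) X \<and>
    (\<forall>j. j \<noteq> 2 * n + 1 \<longrightarrow> fold apply_gadget (padding n k) X j = X j)"
    using X
  proof (induction k arbitrary: X)
    case (Suc k)
    define Y where "Y = X(2 * n + 1 := 0)"
    have "safe n A Y" "\<And>j. j \<noteq> 2 * n + 1 \<Longrightarrow> Y j = X j"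
      "apply_gadget (2 * n + 2, 2 * n + 1, Const 0, Const 1) X = Y"
      using Suc.prems by (simp_all add: Y_def safe_zero safe_upd)
    with Suc.IH[of Y] Suc.prems show ?case
      by (simp add: padding_def safe_zero del: apply_gadget.simps)
  qed (simp add: padding_def)
  then show "along (safe n A) (padding n k) X"
    "j \<noteq> 2 * n + 1 \<Longrightarrow> fold apply_gadget (padding n k) X j = X j"
    by auto
qed

text \<open>Block 0 encodes the input; the other registers start with 0, which is its own code.
  Block I + 1 simulates line I, and the block after these outputs R_1. The size 6 n + 5 comes from
  six gadgets to decode each of n registers and five to encode a result.\<close>

definition block_gadgets :: "nat \<Rightarrow> program \<Rightarrow> nat \<Rightarrow> gadget list" where
  "block_gadgets n P b =
    (if b = 0 then encode n 1 (Var 1) (Const 1) @ padding n (6 * n)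
     else decode_upto n n @
       (if b \<le> length P then
         (case P ! (b - 1) of
           Assign i p q \<Rightarrow> encode n i (unfold_poly n p) (unfold_poly n q)
         | Branch _ _ _ \<Rightarrow> padding n 5)
        else (2 * n + 2, 1, Mul (Var 1) (Var (n + 1)), Const 1) # padding n 4))"

text \<open>A gadget occupies three lines but runs for two steps; the final jump adds one to both
  counts.\<close>

abbreviation block_size :: "nat \<Rightarrow> nat" where
  "block_size n \<equiv> 3 * (6 * n + 5) + 1"

abbreviation block_time :: "nat \<Rightarrow> nat" where
  "block_time n \<equiv> 2 * (6 * n + 5) + 1"

text \<open>All counters beyond the program share the output block. Monotonicity in I is what makes
  limits of counters correspond.\<close>

definition start :: "nat \<Rightarrow> program \<Rightarrow> nat \<Rightarrow> nat" where
  "start n P I = (1 + min I (length P)) * block_size n"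

text \<open>Branches with equal targets serve as unconditional jumps; the output block jumps just
  past the end and thereby halts. A simulated branch can test the code, since \<open>enc\<close>
  preserves signs.\<close>

definition block_jump :: "nat \<Rightarrow> program \<Rightarrow> nat \<Rightarrow> instr" where
  "block_jump n P b =
    (if b = 0 then Branch 1 (start n P 0) (start n P 0)
     else if b \<le> length P then
       (case P ! (b - 1) of
         Assign _ _ _ \<Rightarrow> Branch 1 (start n P b) (start n P b)
       | Branch i k l \<Rightarrow> Branch i (start n P k) (start n P l))
     else Branch 1 ((length P + 2) * block_size n) ((length P + 2) * block_size n))"

definition simulator :: "nat \<Rightarrow> program \<Rightarrow> program" where
  "simulator n P =
    assemble (6 * n + 5) (length P + 2) (block_gadgets n P) (block_jump n P)"

lemma length_simulator: "length (simulator n P) = (length P + 2) * block_size n"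
  by (simp add: simulator_def length_assemble)

lemma length_block_gadgets: "length (block_gadgets n P b) = 6 * n + 5"
  by (simp add: block_gadgets_def length_gadgets split: instr.split)

section \<open>Well-formedness of the simulating program\<close>

lemma wf_decode: "j \<in> {1..n} \<Longrightarrow> g \<in> set (decode n j) \<Longrightarrow> wf_gadget (2 * n + 2) g"
proof -
  have "\<exists>\<rho>. \<rho> k \<noteq> (0 :: real)" for k :: nat
    by (rule exI[of _ "\<lambda>_. 1"]) simp
  then show "j \<in> {1..n} \<Longrightarrow> g \<in> set (decode n j) \<Longrightarrow> wf_gadget (2 * n + 2) g"
    by (auto simp: decode_def)
qed

lemma wf_decode_upto: "g \<in> set (decode_upto n n) \<Longrightarrow> wf_gadget (2 * n + 2) g"
proof -
  assume "g \<in> set (decode_upto n n)"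
  then obtain j where "j \<in> {1..n}" "g \<in> set (decode n j)"
    by (auto simp: decode_upto_def less_Suc_eq_le simp del: upt_Suc)
  then show ?thesis
    by (rule wf_decode)
qed

lemma wf_padding: "g \<in> set (padding n k) \<Longrightarrow> wf_gadget (2 * n + 2) g"
  by (auto simp: padding_def)

lemma wf_encode:
  assumes i: "i \<in> {1..n}" and "vars p \<subseteq> {1..2 * n}" "vars q \<subseteq> {1..2 * n}"
    and \<rho>: "poly_val q \<rho> \<noteq> 0" and g: "g \<in> set (encode n i p q)"
  shows "wf_gadget (2 * n + 2) g"
proof -
  \<comment> \<open>With the sign register set to 0, the denominator of the last gadget reduces to
    q.\<close>
  have "poly_val q (\<rho>(Suc (2 * n) := 0)) = poly_val q \<rho>"
    using assms(3) by (intro poly_val_cong) auto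
  then have "\<exists>\<rho>. poly_val q \<rho> - \<rho> (Suc (2 * n)) * poly_val p \<rho> \<noteq> 0"
    using \<rho> by (intro exI[of _ "\<rho>(Suc (2 * n) := 0)"]) simp
  moreover have "\<exists>\<rho>. poly_val p \<rho> * poly_val p \<rho> + poly_val q \<rho> * poly_val q \<rho> \<noteq> 0"
    using \<rho> by (intro exI[of _ \<rho>]) (simp add: sum_squares_eq_zero_iff)
  moreover have "vars p \<subseteq> {1..2 * n + 2}" "vars q \<subseteq> {1..2 * n + 2}"
    using assms(2,3) by (auto simp: subset_iff)
  ultimately show ?thesis
    using g i by (auto simp: encode_def)
qed

lemma wf_unfold_poly:
  assumes "vars q \<subseteq> {1..n}" and "poly_val q \<rho> \<noteq> 0"
  shows "\<exists>\<rho>. poly_val (unfold_poly n q) \<rho> \<noteq> 0"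
proof -
  \<comment> \<open>Scaling registers set to 1 turn the substituted polynomial back into q.\<close>
  have "poly_val (unfold_poly n q) (\<lambda>v. if v \<le> n then \<rho> v else 1) = poly_val q \<rho>"
    unfolding poly_val_unfold_poly using assms(1) by (intro poly_val_cong) auto
  with assms(2) show ?thesis
    by metis
qed

lemma BSS_program_simulator:
  assumes P: "BSS_program n P"
  shows "BSS_program (2 * n + 2) (simulator n P)"
proof -
  have n: "1 \<le> n" and wf: "\<And>c. c \<in> set P \<Longrightarrow> wf_instr n c"
    using P by (auto simp: BSS_program_def)
  have line: "wf_instr n (P ! (b - 1))" if "0 < b" "b \<le> length P" for b
    using that by (intro wf nth_mem) auto
  have gad: "wf_gadget (2 * n + 2) g" if "g \<in> set (block_gadgets n P b)" for b g
  proof (cases "b = 0 \<or> b > length P")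
    case True
    have "wf_gadget (2 * n + 2) g" if "g \<in> set (encode n 1 (Var 1) (Const 1))"
      using n by (intro wf_encode[OF _ _ _ _ that, of "\<lambda>_. 0"]) auto
    moreover have "g \<in> set (encode n 1 (Var 1) (Const 1)) \<or> (\<exists>k. g \<in> set (padding n k)) \<or>
        g \<in> set (decode_upto n n) \<or> g = (2 * n + 2, 1, Mul (Var 1) (Var (n + 1)), Const 1)"
      using that True by (auto simp: block_gadgets_def split: if_splits)
    moreover have "wf_gadget (2 * n + 2) (2 * n + 2, 1, Mul (Var 1) (Var (n + 1)), Const 1)"
      by simp
    ultimately show ?thesis
      using wf_padding wf_decode_upto by blast
  next
    case False
    have "wf_gadget (2 * n + 2) g"
      if c: "P ! (b - 1) = Assign i p q" and g: "g \<in> set (encode n i (unfold_poly n p) (unfold_poly n q))" for i p q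
    proof -
      obtain \<rho> where "i \<in> {1..n}" "vars p \<subseteq> {1..n}" "vars q \<subseteq> {1..n}" "poly_val q \<rho> \<noteq> 0"
        using line[of b, unfolded c] False by auto
      then show ?thesis
        using wf_unfold_poly[of q n \<rho>] vars_unfold_poly[of p n] vars_unfold_poly[of q n]
          wf_encode[OF _ _ _ _ g] by blast
    qed
    moreover have "(\<exists>i p q. P ! (b - 1) = Assign i p q \<and>
          g \<in> set (encode n i (unfold_poly n p) (unfold_poly n q))) \<or>
        (\<exists>k. g \<in> set (padding n k)) \<or> g \<in> set (decode_upto n n)"
      using that False by (auto simp: block_gadgets_def split: if_splits instr.splits)
    ultimately show ?thesis
      using wf_padding wf_decode_upto by blast
  qed
  have jump: "wf_instr (2 * n + 2) (block_jump n P b)" for b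
    using line[of b] by (auto simp: block_jump_def split: instr.split)
  have "wf_instr (2 * n + 2) c" if "c \<in> set (simulator n P)" for c
    by (rule set_assemble[OF length_block_gadgets gad jump that[unfolded simulator_def]])
  then show ?thesis
    by (simp add: BSS_program_def)
qed

section \<open>Runs of single blocks\<close>

lemma simulator_block:
  assumes b: "b < length P + 2" and Q: "along Q (block_gadgets n P b) X"
    and jump: "block_jump n P b = Branch i a a'"
  defines "c \<equiv> \<lambda>k. (nxt (simulator n P) ^^ k) (X, b * block_size n)"
    and "Y \<equiv> fold apply_gadget (block_gadgets n P b) X"
  shows "k < block_time n \<Longrightarrow> Q (fst (c k)) \<and> snd (c k) \<in> {b * block_size n..<(b + 1) * block_size n} \<and>
      step (simulator n P) (c k) = Some (c (Suc k))"
    and "c (block_time n) = (Y, if Y i > 0 then a else a')"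
    and "j \<le> 6 * n + 5 \<Longrightarrow> fst (c (2 * j)) = regs (block_gadgets n P b) X j"
proof -
  have ok: "gadget_ok (block_gadgets n P b ! g) (regs (block_gadgets n P b) X g)"
    if "g < 6 * n + 5" for g
    using that by (intro along_ok[OF Q]) (simp add: length_block_gadgets)
  note run = block_run[where gs = "block_gadgets n P" and br = "block_jump n P",
      OF b length_block_gadgets ok _ jump, folded simulator_def]
  show "c (block_time n) = (Y, if Y i > 0 then a else a')"
    using run(4)[of 0] unfolding c_def Y_def by (simp add: length_block_gadgets)
  show "fst (c (2 * j)) = regs (block_gadgets n P b) X j" if "j \<le> 6 * n + 5"
    using block_run_even[where gs = "block_gadgets n P" and br = "block_jump n P",
        OF b length_block_gadgets ok that, folded simulator_def]
    unfolding c_def by simp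
  show "Q (fst (c k)) \<and> snd (c k) \<in> {b * block_size n..<(b + 1) * block_size n} \<and>
      step (simulator n P) (c k) = Some (c (Suc k))" if k: "k < block_time n"
    using run(1-3)[OF _ k] along_regs[OF Q] unfolding c_def by (auto simp: algebra_simps)
qed

definition represents :: "nat \<Rightarrow> (nat \<Rightarrow> real) \<Rightarrow> (nat \<Rightarrow> real) \<Rightarrow> bool" where
  "represents n R X \<longleftrightarrow> (\<forall>j\<in>{1..n}. \<bar>X j\<bar> \<le> 1 \<and> dec (X j) = R j)"

lemma represents_enc: "(\<And>j. j \<in> {1..n} \<Longrightarrow> X j = enc (R j)) \<Longrightarrow> represents n R X"
  by (simp add: represents_def less_imp_le abs_enc_less)

lemma init_run:
  fixes x :: real and P :: program
  assumes n: "1 \<le> n"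
  defines "c \<equiv> \<lambda>k. (nxt (simulator n P) ^^ k) (init x)"
  shows "k < block_time n \<Longrightarrow> step (simulator n P) (c k) = Some (c (Suc k))"
    and "\<exists>Y. c (block_time n) = (Y, start n P 0) \<and> safe n (\<lambda>_. UNIV) Y \<and>
      (\<forall>j\<in>{1..n}. Y j = enc (fst (init x) j))"
proof -
  define X where "X = fst (init x)"
  have X: "safe n (\<lambda>_. UNIV) X" and X1: "X 1 = x"
    using n by (auto simp: safe_def X_def init_def)
  define Z where "Z = fold apply_gadget (encode n 1 (Var 1) (Const 1)) X"
  define Y where "Y = fold apply_gadget (block_gadgets n P 0) X"
  have "along (safe n (\<lambda>_. UNIV)) (encode n 1 (Var 1) (Const 1)) X" and Z1: "Z 1 = enc x"
    and Zj: "\<And>j. j \<noteq> 1 \<Longrightarrow> j \<noteq> 2 * n + 1 \<Longrightarrow> Z j = X j"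
    unfolding Z_def using encode_along[OF X, of 1 "Var 1" "Const 1"] n X1 by auto
  moreover from this(1) have Z: "safe n (\<lambda>_. UNIV) Z"
    unfolding Z_def by (rule along_fold)
  ultimately have along: "along (safe n (\<lambda>_. UNIV)) (block_gadgets n P 0) X"
    using padding_along(1)[OF Z, of "6 * n"]
    by (simp add: block_gadgets_def along_append Z_def)
  have "Y j = enc (X j)" if "j \<in> {1..n}" for j
  proof -
    have "Y j = Z j"
      unfolding Y_def using padding_along(2)[OF Z, of j "6 * n"] that
      by (simp add: block_gadgets_def Z_def)
    also have "\<dots> = enc (X j)"
      using that Z1 Zj[of j] by (cases "j = 1") (auto simp: X_def init_def)
    finally show ?thesis .
  qed
  moreover have "init x = (X, 0 * block_size n)"
    by (simp add: X_def init_def)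
  moreover have jump: "block_jump n P 0 = Branch 1 (start n P 0) (start n P 0)"
    by (simp add: block_jump_def)
  ultimately show "k < block_time n \<Longrightarrow> step (simulator n P) (c k) = Some (c (Suc k))"
    "\<exists>Y. c (block_time n) = (Y, start n P 0) \<and> safe n (\<lambda>_. UNIV) Y \<and>
      (\<forall>j\<in>{1..n}. Y j = enc (fst (init x) j))"
    using simulator_block(1,2)[OF _ along jump] along_fold[OF along]
    unfolding c_def X_def[symmetric] Y_def by simp_all
qed

context
  fixes n :: nat and P :: program and X R :: "nat \<Rightarrow> real" and I :: nat
    and c :: "nat \<Rightarrow> snapshot"
  assumes P: "BSS_program n P" and X: "safe n (\<lambda>_. UNIV) X" and rep: "represents n R X"
  defines "c \<equiv> \<lambda>k. (nxt (simulator n P) ^^ k) (X, start n P I)"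
begin

lemma decode_represents:
  assumes "\<And>j. j \<in> {1..n} \<Longrightarrow> X j \<in> A j" "\<And>j. j \<in> {1..n} \<Longrightarrow> enc (R j) \<in> A j"
  defines "Z \<equiv> fold apply_gadget (decode_upto n n) X"
  shows "along (safe n A) (decode_upto n n) X" "safe n A Z"
    "j \<in> {1..n} \<Longrightarrow> Z j = enc (R j)" "j \<in> {1..n} \<Longrightarrow> Z (n + j) = 1 + \<bar>R j\<bar>"
    "vars p \<subseteq> {1..n} \<Longrightarrow> poly_val (unfold_poly n p) Z = poly_val p R"
proof -
  have *: "j \<in> {1..n} \<Longrightarrow> \<bar>X j\<bar> \<le> 1 \<and> dec (X j) = R j" for j
    using rep by (simp add: represents_def)
  have A: "safe n A X"
    using X assms(1) by (auto simp: safe_def)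
  from decode_upto_along[OF this _ order_refl] * assms(2)
  have D: "along (safe n A) (decode_upto n n) X \<and>
     (\<forall>j\<in>{1..n}. Z j = enc (dec (X j)) \<and> Z (n + j) = 1 + \<bar>dec (X j)\<bar>)"
    unfolding Z_def by auto
  then show "along (safe n A) (decode_upto n n) X"
    by blast
  then show "safe n A Z"
    unfolding Z_def by (rule along_fold)
  show Zj: "Z j = enc (R j)" "Z (n + j) = 1 + \<bar>R j\<bar>" if "j \<in> {1..n}" for j
    using D * that by auto
  show "poly_val (unfold_poly n p) Z = poly_val p R" if "vars p \<subseteq> {1..n}"
    unfolding poly_val_unfold_poly using that Zj enc_mult by (intro poly_val_cong) auto
qed

text \<open>During the block, register j holds only its entry content, the code of R_j or the code
  of the new R_j. The last claim is needed because the entry content may be 1, above the code of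
  R_j; an upper estimate of later limits requires that the code itself shows up.\<close>

lemma step_run:
  assumes step: "step P (R, I) = Some (R', I')"
  defines "A \<equiv> \<lambda>j. {X j, enc (R j), enc (R' j)}"
  shows "k < block_time n \<Longrightarrow> safe n A (fst (c k)) \<and>
      snd (c k) \<in> {start n P I..<start n P I + block_size n} \<and>
      step (simulator n P) (c k) = Some (c (Suc k))"
    and "\<exists>Y. c (block_time n) = (Y, start n P I') \<and> safe n A Y \<and> (\<forall>j\<in>{1..n}. Y j = enc (R' j))"
    and "\<exists>k<block_time n. \<forall>j\<in>{1..n}. fst (c k) j = enc (R j)"
proof -
  have I: "I < length P" and ex: "exec (P ! I) (R, I) = Some (R', I')"
    using step by (auto simp: step_def halted_def split: if_splits)
  have wf: "wf_instr n (P ! I)"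
    using P I by (auto simp: BSS_program_def)
  have st: "start n P I = (I + 1) * block_size n"
    using I by (simp add: start_def)
  have b: "I + 1 < length P + 2"
    using I by simp
  define Z where "Z = fold apply_gadget (decode_upto n n) X"
  define Y where "Y = fold apply_gadget (block_gadgets n P (I + 1)) X"
  have A: "X j \<in> A j" "enc (R j) \<in> A j" "enc (R' j) \<in> A j" for j
    by (simp_all add: A_def)
  note D = decode_represents[OF A(1,2), folded Z_def]
  obtain i a a' where jump: "block_jump n P (I + 1) = Branch i a a'"
    and along: "along (safe n A) (block_gadgets n P (I + 1)) X"
    and Y: "\<And>j. j \<in> {1..n} \<Longrightarrow> Y j = enc (R' j)"
    and next_pc: "(if Y i > 0 then a else a') = start n P I'"
  proof (cases "P ! I")
    case (Assign i p q)
    then have wf': "i \<in> {1..n}" "vars p \<subseteq> {1..n}" "vars q \<subseteq> {1..n}"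
      using wf by auto
    have q: "poly_val q R \<noteq> 0" and R': "R' = R(i := poly_val p R / poly_val q R)" and I': "I' = I + 1"
      using ex Assign by (auto split: if_splits)
    have gs: "block_gadgets n P (I + 1) = decode_upto n n @ encode n i (unfold_poly n p) (unfold_poly n q)"
      using I Assign by (simp add: block_gadgets_def)
    have M: "2 * n + 1 \<notin> vars (unfold_poly n p)" "2 * n + 1 \<notin> vars (unfold_poly n q)"
      using vars_unfold_poly[OF wf'(2)] vars_unfold_poly[OF wf'(3)] by auto
    have "enc (poly_val p R / poly_val q R) \<in> A i"
      using A(3)[of i] R' by simp
    then have E: "along (safe n A) (encode n i (unfold_poly n p) (unfold_poly n q)) Z"
      "fold apply_gadget (encode n i (unfold_poly n p) (unfold_poly n q)) Z i = 
        enc (poly_val p R / poly_val q R)"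
      "\<And>j. j \<noteq> i \<Longrightarrow> j \<noteq> 2 * n + 1 \<Longrightarrow>
        fold apply_gadget (encode n i (unfold_poly n p) (unfold_poly n q)) Z j = Z j"
      using encode_along[OF D(2) wf'(1) M] D(5) wf' q by simp_all
    have Y: "Y = fold apply_gadget (encode n i (unfold_poly n p) (unfold_poly n q)) Z"
      unfolding Y_def gs Z_def by simp
    show ?thesis
    proof (rule that)
      show "block_jump n P (I + 1) = Branch 1 (start n P (I + 1)) (start n P (I + 1))"
        using I Assign by (simp add: block_jump_def)
      show "along (safe n A) (block_gadgets n P (I + 1)) X"
        using D(1) E(1) unfolding gs along_append Z_def ..
      show "Y j = enc (R' j)" if "j \<in> {1..n}" for j
        using that E(2,3) D(3) by (cases "j = i") (simp_all add: Y R')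
    qed (simp add: I')
  next
    case (Branch i k l)
    then have i: "i \<in> {1..n}" and R': "R' = R" and I': "I' = (if 0 < R i then k else l)"
      using wf ex by auto
    have gs: "block_gadgets n P (I + 1) = decode_upto n n @ padding n 5"
      using I Branch by (simp add: block_gadgets_def)
    have "Y = fold apply_gadget (padding n 5) Z"
      unfolding Y_def gs Z_def by simp
    then have Yj: "Y j = enc (R' j)" if "j \<in> {1..n}" for j
      using that padding_along(2)[OF D(2), of j 5] D(3)[OF that] by (simp add: R')
    show ?thesis
    proof (rule that)
      show "block_jump n P (I + 1) = Branch i (start n P k) (start n P l)"
        using I Branch by (simp add: block_jump_def)
      show "along (safe n A) (block_gadgets n P (I + 1)) X"
        using D(1) padding_along(1)[OF D(2), of 5] unfolding gs along_append Z_def ..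
      show "(if Y i > 0 then start n P k else start n P l) = start n P I'"
        using Yj[OF i] by (simp add: R' I' enc_pos_iff)
    qed (fact Yj)
  qed
  note run = simulator_block[OF b along jump, folded st c_def Y_def]
  show "k < block_time n \<Longrightarrow> safe n A (fst (c k)) \<and>
      snd (c k) \<in> {start n P I..<start n P I + block_size n} \<and>
      step (simulator n P) (c k) = Some (c (Suc k))"
    using run(1)[of k] by (simp add: st c_def)
  show "\<exists>Y. c (block_time n) = (Y, start n P I') \<and> safe n A Y \<and> (\<forall>j\<in>{1..n}. Y j = enc (R' j))"
    using run(2) next_pc Y along_fold[OF along] unfolding c_def by (auto simp: Y_def)
  \<comment> \<open>Decoding is complete after 6 n gadgets, that is, after twice as many
    steps.\<close>
  have "regs (block_gadgets n P (I + 1)) X (6 * n) = Z"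
    using I by (simp add: block_gadgets_def Z_def length_gadgets)
  then have "fst (c (2 * (6 * n))) = Z"
    using run(3)[of "6 * n"] unfolding c_def by simp
  then show "\<exists>k<block_time n. \<forall>j\<in>{1..n}. fst (c k) j = enc (R j)"
    using D(3) by (intro exI[of _ "2 * (6 * n)"]) simp
qed

text \<open>Here R_1 is stored uncompressed. This is harmless, as the machine halts within the block
  and no limit follows.\<close>

lemma halted_run:
  assumes I: "halted P (R, I)"
  shows "k < block_time n \<Longrightarrow> step (simulator n P) (c k) = Some (c (Suc k))"
    and "halted (simulator n P) (c (block_time n))" "fst (c (block_time n)) 1 = R 1"
proof -
  have n: "1 \<le> n"
    using P by (simp add: BSS_program_def)
  define b where "b = length P + 1"
  have st: "start n P I = b * block_size n"
    using I by (simp add: start_def halted_def b_def)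
  have b: "b < length P + 2"
    by (simp add: b_def)
  define Z where "Z = fold apply_gadget (decode_upto n n) X"
  define g where "g = (2 * n + 2, 1 :: nat, Mul (Var 1) (Var (n + 1)), Const 1 :: nat rat_poly)"
  note D = decode_represents[of "\<lambda>_. UNIV", folded Z_def]
  have gs: "block_gadgets n P b = decode_upto n n @ g # padding n 4"
    by (simp add: block_gadgets_def g_def b_def)
  have "Z 1 * Z (n + 1) = R 1"
    using D(3,4)[of 1] n enc_mult[of "R 1"] by auto
  then have g: "apply_gadget g Z = Z(1 := R 1)"
    using D(2) by (simp add: g_def safe_zero)
  have safe: "safe n (\<lambda>_. UNIV) (Z(1 := R 1))"
    using D(2) n by (intro safe_upd) auto
  have along: "along (safe n (\<lambda>_. UNIV)) (block_gadgets n P b) X"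
    using D(1,2) padding_along(1)[OF safe, of 4] g
    by (simp add: gs along_append Z_def[symmetric]) (simp add: g_def)
  have jump: "block_jump n P b =
      Branch 1 ((length P + 2) * block_size n) ((length P + 2) * block_size n)"
    by (simp add: block_jump_def b_def)
  note run = simulator_block[OF b along jump, folded st c_def]
  show "k < block_time n \<Longrightarrow> step (simulator n P) (c k) = Some (c (Suc k))"
    using run(1) by (simp add: c_def)
  show "halted (simulator n P) (c (block_time n))"
    using run(2) by (simp add: c_def halted_def length_simulator)
  show "fst (c (block_time n)) 1 = R 1"
    using run(2) padding_along(2)[OF safe, of 1 4] n g by (simp add: c_def gs flip: Z_def)
qed

end

subsection \<open>Refining the time scale\<close>

text \<open>
  Each time \<open>s\<close> up to \<open>e\<close> is replaced by \<open>len s\<close> consecutive times \<open>tick s k\<close>. The bijection \<open>h\<close>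
  makes elements of the original type out of the pairs \<open>(s, k)\<close>.
\<close>

locale refined_time =
  fixes r :: "'o rel" and e :: 'o and len :: "'o \<Rightarrow> nat" and h :: "'o \<Rightarrow> 'o \<times> nat"
  assumes r: "Well_order r" and e: "e \<in> Field r" and len: "0 < len s" and h: "bij h"
begin

definition mac :: "'o \<Rightarrow> 'o" where "mac a = fst (h a)"
definition mic :: "'o \<Rightarrow> nat" where "mic a = snd (h a)"
definition tick :: "'o \<Rightarrow> nat \<Rightarrow> 'o" where "tick s k = inv h (s, k)"

definition times :: "'o set" where
  "times = {a. mac a \<in> under r e \<and> mic a < len (mac a)}"

definition rr :: "'o rel" where
  "rr = {(a, b). a \<in> times \<and> b \<in> times \<and>
    (mac a \<in> underS r (mac b) \<or> mac a = mac b \<and> mic a \<le> mic b)}"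

lemma mac_tick [simp]: "mac (tick s k) = s" and mic_tick [simp]: "mic (tick s k) = k"
  using bij_is_surj[OF h] by (simp_all add: mac_def mic_def tick_def surj_f_inv_f)

lemma tick_mac_mic [simp]: "tick (mac a) (mic a) = a"
  using bij_is_inj[OF h] by (simp add: mac_def mic_def tick_def)

lemma eq_iff: "a = b \<longleftrightarrow> mac a = mac b \<and> mic a = mic b"
  by (metis tick_mac_mic)

lemma tick_in_times: "s \<in> under r e \<Longrightarrow> k < len s \<Longrightarrow> tick s k \<in> times"
  by (simp add: times_def)

lemma under_e_Field: "s \<in> under r e \<Longrightarrow> s \<in> Field r"
  by (auto simp: under_def Field_def)

lemma under_e_closed: "t \<in> under r e \<Longrightarrow> s \<in> underS r t \<Longrightarrow> s \<in> underS r e"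
  using under_eq[OF r e] underS_trans[OF r] by auto

lemma underS_e: "s \<in> underS r e \<Longrightarrow> s \<in> under r e"
  using under_eq[OF r e] by simp

lemma Field_rr: "Field rr = times"
  by (auto simp: Field_def rr_def)

lemma underS_rr: "a \<in> times \<Longrightarrow> b \<in> underS rr a \<longleftrightarrow>
    b \<in> times \<and> (mac b \<in> underS r (mac a) \<or> mac b = mac a \<and> mic b < mic a)"
  using underS_irrefl[of "mac a" r] unfolding underS_def[of rr]
  by (auto simp: rr_def eq_iff[of b a])

lemma under_rr: "b \<in> under rr a \<longleftrightarrow> a \<in> times \<and> b \<in> times \<and>
    (mac b \<in> underS r (mac a) \<or> mac b = mac a \<and> mic b \<le> mic a)"
  by (auto simp: under_def rr_def)

lemma times_mac: "a \<in> times \<Longrightarrow> mac a \<in> Field r"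
  using under_e_Field by (simp add: times_def)

lemma Well_order_rr: "Well_order rr"
proof -
  have "wf (rr - Id)"
  proof (rule wf_subset)
    show "wf (inv_image ({(s, t). s \<in> underS r t} <*lex*> less_than) h)"
      by (intro wf_inv_image wf_lex_prod wf_underS r wf_less_than)
    show "rr - Id \<subseteq> inv_image ({(s, t). s \<in> underS r t} <*lex*> less_than) h"
    proof (rule subrelI)
      fix a b assume "(a, b) \<in> rr - Id"
      moreover from this have "mac a \<noteq> mac b \<or> mic a \<noteq> mic b"
        using eq_iff[of a b] by simp
      ultimately show "(a, b) \<in> inv_image ({(s, t). s \<in> underS r t} <*lex*> less_than) h"
        by (cases "h a"; cases "h b") (auto simp: rr_def mac_def mic_def)
    qed
  qed
  moreover have "refl_on times rr"
    by (auto simp: refl_on_def rr_def)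
  moreover have "trans rr"
    using underS_trans[OF r] by (auto simp: trans_def rr_def)
  moreover have "antisym rr"
  proof -
    have "t \<notin> underS r s" if "s \<in> underS r t" for s t
      using that underS_trans[OF r that] underS_irrefl by fast
    then show ?thesis
      by (intro antisymI) (auto simp: rr_def underS_irrefl intro: eq_iff[THEN iffD2])
  qed
  moreover have "total_on times rr"
    using underS_total[OF r times_mac times_mac] by (auto simp: total_on_def rr_def)
  ultimately show ?thesis
    unfolding order_on_defs Field_rr
    by (auto simp: rr_def)
qed

context
  fixes t :: 'o
  assumes t: "limit_time r t" "t \<in> under r e"
begin

lemma tick_0_times: "tick t 0 \<in> times"
  using t len by (intro tick_in_times)

lemma underS_rr_tick_0: "a \<in> underS rr (tick t 0) \<longleftrightarrow> a \<in> times \<and> mac a \<in> underS r t"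
  by (simp add: underS_rr[OF tick_0_times])

text \<open>A refined time b below \<open>tick t 0\<close> belongs to some coarse time before t. As
  t is a limit, a further coarse time s lies between, and \<open>tick s 0\<close> separates b from
  \<open>tick t 0\<close>.\<close>

lemma limit_time_rr: "limit_time rr (tick t 0)"
proof -
  obtain s where "s \<in> underS r t"
    using t(1) by (auto simp: limit_time_def zero_time_def)
  then have "tick s 0 \<in> underS rr (tick t 0)"
    using under_e_closed[OF t(2)] underS_e len by (simp add: underS_rr_tick_0 tick_in_times)
  moreover have "\<not> succ_time rr b (tick t 0)" for b
  proof
    assume b: "succ_time rr b (tick t 0)"
    then have "b \<in> times" "mac b \<in> underS r t"
      by (auto simp: succ_time_def underS_rr_tick_0)
    then obtain s where s: "mac b \<in> underS r s" "s \<in> underS r t"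
      using limit_time_next[OF r t(1)] by (auto simp: succ_time_def)
    then have s_times: "tick s 0 \<in> times"
      using under_e_closed[OF t(2)] underS_e len by (simp add: tick_in_times)
    with s have "tick s 0 \<in> underS rr (tick t 0)" "b \<in> underS rr (tick s 0)"
      using \<open>b \<in> times\<close> by (simp_all add: underS_rr_tick_0 underS_rr)
    moreover from this(1) b have "tick s 0 = b \<or> tick s 0 \<in> underS rr b"
      using under_eq[OF Well_order_rr] \<open>b \<in> times\<close> by (auto simp: succ_time_def Field_rr)
    ultimately show False
      using underS_irrefl underS_trans[OF Well_order_rr] by metis
  qed
  ultimately show ?thesis
    by (auto simp: limit_time_def zero_time_def)
qed

lemma eventually_before_rr:
  assumes "\<forall>\<^sub>F s in before r t. \<forall>k<len s. Q (tick s k)"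
  shows "eventually Q (before rr (tick t 0))"
proof -
  obtain b where b: "b \<in> underS r t"
    and Q: "\<And>s k. s \<in> underS r t \<Longrightarrow> b \<in> underS r s \<Longrightarrow> k < len s \<Longrightarrow> Q (tick s k)"
    using assms unfolding eventually_before[OF r t(1)] by blast
  \<comment> \<open>The last tick of b: whatever comes after it belongs to a coarse time after
    b.\<close>
  have "tick b (len b - 1) \<in> underS rr (tick t 0)"
    using b under_e_closed[OF t(2)] underS_e len by (simp add: underS_rr_tick_0 tick_in_times)
  moreover have "Q g" if "g \<in> underS rr (tick t 0)" "tick b (len b - 1) \<in> underS rr g" for g
  proof -
    have g: "g \<in> times" "mac g \<in> underS r t"
      using that(1) by (simp_all add: underS_rr_tick_0)
    then have "b \<in> underS r (mac g)" "mic g < len (mac g)"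
      using that(2) by (auto simp: underS_rr times_def)
    from Q[OF g(2) this] show ?thesis
      by simp
  qed
  ultimately show ?thesis
    unfolding eventually_before[OF Well_order_rr limit_time_rr] by blast
qed

lemma frequently_before_rr:
  assumes "\<exists>\<^sub>F s in before r t. \<exists>k<len s. Q (tick s k)"
  shows "frequently Q (before rr (tick t 0))"
  unfolding frequently_before[OF Well_order_rr limit_time_rr]
proof
  fix b assume "b \<in> underS rr (tick t 0)"
  then have b: "b \<in> times" "mac b \<in> underS r t"
    by (simp_all add: underS_rr_tick_0)
  then obtain s k where "s \<in> underS r t" "mac b \<in> underS r s" "k < len s" "Q (tick s k)"
    using assms unfolding frequently_before[OF r t(1)] by blast
  moreover from this have "tick s k \<in> times"
    using under_e_closed[OF t(2)] underS_e by (simp add: tick_in_times)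
  ultimately show "\<exists>g\<in>underS rr (tick t 0). b \<in> underS rr g \<and> Q g"
    using b by (intro bexI[of _ "tick s k"]) (simp_all add: underS_rr_tick_0 underS_rr)
qed

end

text \<open>B gives the snapshot at the first tick of each coarse time, and iteration gives the
  others. A first tick inherits the kind of its coarse time, its predecessor in the successor case
  being the last tick of the preceding coarse time; any other tick has a predecessor in the same
  coarse time.\<close>

lemma refined_computation:
  fixes B :: "'o \<Rightarrow> snapshot" and Q :: program
  defines "D \<equiv> \<lambda>a. (nxt Q ^^ mic a) (B (mac a))"
  assumes zero: "\<And>t. t \<in> under r e \<Longrightarrow> zero_time r t \<Longrightarrow> B t = init x"
    and step: "\<And>s k. s \<in> under r e \<Longrightarrow> k < len s \<Longrightarrow> Suc k < len s \<or> s \<noteq> e \<Longrightarrow>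
      step Q ((nxt Q ^^ k) (B s)) = Some ((nxt Q ^^ Suc k) (B s))"
    and succ: "\<And>s t. t \<in> under r e \<Longrightarrow> succ_time r s t \<Longrightarrow> B t = (nxt Q ^^ len s) (B s)"
    and limit_pc: "\<And>t. t \<in> under r e \<Longrightarrow> limit_time r t \<Longrightarrow>
      snd (B t) = liminf_pc rr (tick t 0) (\<lambda>a. snd (D a))"
    and limit: "\<And>t i. t \<in> under r e \<Longrightarrow> limit_time r t \<Longrightarrow> i \<in> {1..n} \<Longrightarrow>
      SITBM rr (tick t 0) (\<lambda>a. fst (D a) i) (fst (B t) i)"
  shows "computation SITBM n Q x rr D"
proof -
  have "(zero_time rr a \<longrightarrow> D a = init x) \<and>
      (\<forall>b. succ_time rr b a \<longrightarrow> step Q (D b) = Some (D a)) \<and>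
      (limit_time rr a \<longrightarrow>
         snd (D a) = liminf_pc rr a (\<lambda>s. snd (D s)) \<and>
         (\<forall>i\<in>{1..n}. SITBM rr a (\<lambda>s. fst (D s) i) (fst (D a) i)))" if a: "a \<in> times" for a
  proof -
    define s where "s = mac a"
    have s: "s \<in> under r e" "mic a < len s"
      using a by (simp_all add: s_def times_def)
    \<comment> \<open>A predecessor is unique and excludes the zero and limit cases, so one correct
      step settles the goal.\<close>
    have pred: ?thesis if "succ_time rr b a" "step Q (D b) = Some (D a)" for b
      using that succ_time_unique[OF Well_order_rr] unfolding limit_time_def zero_time_def succ_time_def
      by blast
    show ?thesis
    proof (cases "mic a")
      case (Suc k)
      have k: "tick s k \<in> times" "Suc k < len s"
        using s Suc by (simp_all add: times_def)
      have "underS rr a = under rr (tick s k)"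
        using k a by (auto simp: under_rr underS_rr s_def Suc)
      moreover have "tick s k \<in> underS rr a"
        using k a by (simp add: underS_rr s_def Suc)
      ultimately have "succ_time rr (tick s k) a"
        by (simp add: succ_time_def)
      moreover have "step Q (D (tick s k)) = Some (D a)"
        using step[OF s(1), of k] k by (simp add: D_def Suc flip: s_def)
      ultimately show ?thesis
        by (rule pred)
    next
      case 0
      then have Da: "D a = B s" and a_tick: "a = tick s 0"
        by (simp add: D_def s_def) (simp add: s_def flip: 0)
      consider "zero_time r s" | u where "succ_time r u s" | "limit_time r s"
        by (auto simp: limit_time_def)
      then show ?thesis
      proof cases
        case 1
        then have "underS rr a = {}"
          using a 0 by (auto simp: underS_rr zero_time_def s_def)
        then show ?thesis
          using zero[OF s(1) 1] Da by (simp add: zero_time_def succ_time_def limit_time_def)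
      next
        case (2 u)
        then have us: "u \<in> underS r s" "underS r s = under r u"
          unfolding succ_time_def by blast+
        have u: "u \<in> underS r e" "u \<in> under r e" "u \<noteq> e"
          using under_e_closed[OF s(1) us(1)] underS_e underS_irrefl by auto
        have u': "tick u (len u - 1) \<in> times"
          using u len by (simp add: tick_in_times)
        have "underS rr a = under rr (tick u (len u - 1))"
        proof (rule set_eqI)
          fix b
          have "b \<in> underS rr a \<longleftrightarrow> b \<in> times \<and> mac b \<in> insert u (underS r u)"
            using a us under_eq[OF r under_e_Field[OF u(2)]] by (simp add: underS_rr 0 flip: s_def)
          also have "\<dots> \<longleftrightarrow> b \<in> under rr (tick u (len u - 1))"
            using u' len[of u] by (auto simp: under_rr times_def)
          finally show "b \<in> underS rr a \<longleftrightarrow> b \<in> under rr (tick u (len u - 1))" .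
        qed
        moreover have "tick u (len u - 1) \<in> underS rr a"
          using u' a us(1) by (simp add: underS_rr flip: s_def)
        ultimately have "succ_time rr (tick u (len u - 1)) a"
          by (simp add: succ_time_def)
        moreover have "step Q (D (tick u (len u - 1))) = Some (D a)"
          using step[OF u(2), of "len u - 1"] succ[OF s(1) 2] u(3) len[of u] Da
          by (simp add: D_def del: funpow.simps)
        ultimately show ?thesis
          by (rule pred)
      next
        case 3
        have "limit_time rr a"
          unfolding a_tick using limit_time_rr[OF 3 s(1)] .
        then show ?thesis
          using limit_pc[OF s(1) 3] limit[OF s(1) 3] Da
          by (auto simp: limit_time_def a_tick[symmetric])
      qed
    qed
  qed
  then show ?thesis
    unfolding computation_def using Well_order_rr by (blast intro: Field_rr[THEN equalityD1, THEN subsetD])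
qed

end

subsection \<open>The simulation\<close>

text \<open>The first time takes T more steps for the initial block. The last time e has one more
  tick, since the halted snapshot reached after the output block has no later coarse time to belong
  to.\<close>

locale simulation =
  refined_time r e len h
  for r :: "'o rel" and e :: 'o and len :: "'o \<Rightarrow> nat" and h :: "'o \<Rightarrow> 'o \<times> nat" +
  fixes n :: nat and P :: program and x :: real and C :: "'o \<Rightarrow> snapshot" and T :: nat
  assumes T: "T = block_time n"
    and len_eq: "len s = (if zero_time r s then T else 0) + T + (if s = e then 1 else 0)"
    and P: "BSS_program n P" and C: "computation SSITBM n P x r C"
    and halted: "halted P (C e)"
begin

abbreviation "sim \<equiv> nxt (simulator n P)"

abbreviation fine :: "('o \<Rightarrow> snapshot) \<Rightarrow> 'o \<Rightarrow> snapshot" where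
  "fine B \<equiv> \<lambda>a. (sim ^^ mic a) (B (mac a))"

text \<open>The block of \<open>P ! 0\<close> at time \<open>0\<close> is preceded by the initial block.\<close>

definition enter :: "'o \<Rightarrow> snapshot \<Rightarrow> snapshot" where
  "enter t c = (if zero_time r t then (sim ^^ T) c else c)"

text \<open>At a limit time the simulated contents alone do not determine the registers, as 0 may be
  represented by -1, 0 or 1. The exact limit inferior is recorded because later limits need to
  compare it with the codes before t.\<close>

definition inv_at :: "'o \<Rightarrow> snapshot \<Rightarrow> bool" where
  "inv_at t c \<longleftrightarrow>
    snd c = start n P (snd (C t)) \<and> safe n (\<lambda>_. UNIV) (fst c) \<and>
    represents n (fst (C t)) (fst c) \<and>
    (\<forall>j\<in>{1..n}. if limit_time r t then has_liminf (before r t) (\<lambda>s. enc (fst (C s) j)) (fst c j)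
      else fst c j = enc (fst (C t) j))"

text \<open>A condition on the snapshot at t that involves B only at earlier times, so that B arises
  by well-founded dependent choice. The invariant is included because it is what guarantees that a
  next snapshot exists.\<close>

definition valid :: "('o \<Rightarrow> snapshot) \<Rightarrow> 'o \<Rightarrow> snapshot \<Rightarrow> bool" where
  "valid B t c \<longleftrightarrow> (t \<in> under r e \<longrightarrow>
     inv_at t (enter t c) \<and>
     (zero_time r t \<longrightarrow> c = init x) \<and>
     (\<forall>s. succ_time r s t \<longrightarrow> c = (sim ^^ len s) (B s)) \<and>
     (limit_time r t \<longrightarrow>
       snd c = liminf_pc rr (tick t 0) (\<lambda>a. snd (fine B a)) \<and>
       (\<forall>i\<in>{1..2*n+2}. SITBM rr (tick t 0) (\<lambda>a. fst (fine B a) i) (fst c i))))"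

lemma n: "1 \<le> n"
  using P by (simp add: BSS_program_def)

lemma C_zero: "t \<in> Field r \<Longrightarrow> zero_time r t \<Longrightarrow> C t = init x"
  and C_succ: "t \<in> Field r \<Longrightarrow> succ_time r s t \<Longrightarrow> step P (C s) = Some (C t)"
  and C_limit_pc: "t \<in> Field r \<Longrightarrow> limit_time r t \<Longrightarrow> snd (C t) = liminf_pc r t (\<lambda>s. snd (C s))"
  and C_limit: "t \<in> Field r \<Longrightarrow> limit_time r t \<Longrightarrow> i \<in> {1..n} \<Longrightarrow>
    SSITBM r t (\<lambda>s. fst (C s) i) (fst (C t) i)"
  using C unfolding computation_def by blast+

lemma not_zero_timeI: "s \<in> underS r t \<Longrightarrow> \<not> zero_time r t"
  by (auto simp: zero_time_def)

lemma next_time: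
  assumes "s \<in> underS r e"
  obtains s' where "succ_time r s s'" "s' \<in> under r e" "step P (C s) = Some (C s')"
  using succ_time_exists[OF r assms] C_succ under_e_Field by blast

lemma step_run_at:
  assumes s: "s \<in> underS r e" "inv_at s c" and s': "succ_time r s s'" "s' \<in> under r e"
  shows "k < T \<Longrightarrow> safe n (\<lambda>j. {fst c j, enc (fst (C s) j), enc (fst (C s') j)}) (fst ((sim ^^ k) c)) \<and>
      snd ((sim ^^ k) c) \<in> {start n P (snd (C s))..<start n P (snd (C s)) + block_size n} \<and>
      step (simulator n P) ((sim ^^ k) c) = Some ((sim ^^ Suc k) c)"
    and "inv_at s' ((sim ^^ T) c)"
    and "\<exists>k<T. \<forall>j\<in>{1..n}. fst ((sim ^^ k) c) j = enc (fst (C s) j)"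
proof -
  have "step P (fst (C s), snd (C s)) = Some (fst (C s'), snd (C s'))"
    using C_succ[OF under_e_Field[OF s'(2)] s'(1)] by simp
  moreover have c: "(fst c, start n P (snd (C s))) = c" and "safe n (\<lambda>_. UNIV) (fst c)"
    "represents n (fst (C s)) (fst c)"
    using s(2) by (auto simp: inv_at_def prod_eq_iff)
  ultimately have "safe n (\<lambda>_. UNIV) (fst c)" "represents n (fst (C s)) (fst c)"
    "step P (fst (C s), snd (C s)) = Some (fst (C s'), snd (C s'))"
    by blast+
  note run = step_run[OF P this, unfolded c, folded T]
  show "k < T \<Longrightarrow>
      safe n (\<lambda>j. {fst c j, enc (fst (C s) j), enc (fst (C s') j)}) (fst ((sim ^^ k) c)) \<and>
      snd ((sim ^^ k) c) \<in> {start n P (snd (C s))..<start n P (snd (C s)) + block_size n} \<and>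
      step (simulator n P) ((sim ^^ k) c) = Some ((sim ^^ Suc k) c)"
    by (rule run(1))
  show "\<exists>k<T. \<forall>j\<in>{1..n}. fst ((sim ^^ k) c) j = enc (fst (C s) j)"
    by (rule run(3))
  obtain Y where Y: "(sim ^^ T) c = (Y, start n P (snd (C s')))"
    "safe n (\<lambda>j. {fst c j, enc (fst (C s) j), enc (fst (C s') j)}) Y"
    "\<forall>j\<in>{1..n}. Y j = enc (fst (C s') j)"
    using run(2) by blast
  moreover have "\<not> limit_time r s'"
    using s'(1) by (auto simp: limit_time_def)
  ultimately show "inv_at s' ((sim ^^ T) c)"
    unfolding inv_at_def using represents_enc[of n Y] safe_mono[OF Y(2)] by simp
qed

lemma sim_len: "s \<noteq> e \<Longrightarrow> (sim ^^ len s) c = (sim ^^ T) (enter s c)"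
  by (simp add: len_eq enter_def funpow_add)

lemma valid_step:
  assumes s: "s \<in> under r e" and B: "valid B s (B s)" and k: "k < len s" "Suc k < len s \<or> s \<noteq> e"
  shows "step (simulator n P) ((sim ^^ k) (B s)) = Some ((sim ^^ Suc k) (B s))"
proof -
  have inv: "inv_at s (enter s (B s))"
    using B s by (simp add: valid_def)
  have "step (simulator n P) ((sim ^^ k) (enter s (B s))) = Some ((sim ^^ Suc k) (enter s (B s)))"
    if k: "k < T" for k
  proof (cases "s = e")
    case True
    let ?c = "enter s (B s)"
    have "(fst ?c, start n P (snd (C s))) = ?c" "safe n (\<lambda>_. UNIV) (fst ?c)"
      "represents n (fst (C s)) (fst ?c)" "halted P (fst (C s), snd (C s))"
      using inv halted True by (auto simp: inv_at_def prod_eq_iff)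
    with halted_run(1)[OF P, folded T, OF _ _ _ k] show ?thesis
      by metis
  next
    case False
    then have "s \<in> underS r e"
      using s under_eq[OF r e] by simp
    then show ?thesis
      using next_time step_run_at(1)[OF _ inv _ _ k] by metis
  qed
  note run = this
  show ?thesis
  proof (cases "zero_time r s")
    case zero: True
    then have init: "B s = init x"
      using B s by (simp add: valid_def)
    show ?thesis
    proof (cases "k < T")
      case True
      then show ?thesis
        using init_run(1)[OF n, folded T] init by simp
    next
      case False
      \<comment> \<open>k counts from the start of the initial block, m from the entry into the next
        one.\<close>
      then obtain m where m: "k = m + T"
        by (metis le_add_diff_inverse2 not_less)
      have "m < T"
        using k zero m by (auto simp: len_eq split: if_splits)
      have eq: "(sim ^^ (i + T)) (B s) = (sim ^^ i) (enter s (B s))" for i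
        by (simp only: enter_def zero if_True funpow_add o_apply)
      from run[OF \<open>m < T\<close>] show ?thesis
        unfolding m eq[symmetric] add_Suc .
    qed
  next
    case False
    then show ?thesis
      using run[of k] k by (auto simp: len_eq enter_def split: if_splits)
  qed
qed

text \<open>Refinement inserts only snapshots that leave the limits inferior unchanged: within a
  block the counter never falls below the block's start, and each main register takes only the three
  values of \<open>step_run\<close>, the exact code among them.\<close>

lemma limit_exists:
  assumes t: "limit_time r t" "t \<in> under r e"
    and B: "\<And>s. s \<in> underS r t \<Longrightarrow> valid B s (B s)"
  shows "\<exists>c. inv_at t c \<and> snd c = liminf_pc rr (tick t 0) (\<lambda>a. snd (fine B a)) \<and>
    (\<forall>i\<in>{1..2*n+2}. SITBM rr (tick t 0) (\<lambda>a. fst (fine B a) i) (fst c i))"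
proof -
  let ?F = "before rr (tick t 0)"
  note rr = Well_order_rr limit_time_rr[OF t]
  note t' = under_e_Field[OF t(2)]
  have s_e: "s \<in> underS r e" if "s \<in> underS r t" for s
    using under_e_closed[OF t(2) that] .
  have inv: "inv_at s (B s)" "len s = T" if "s \<in> underS r t" "b \<in> underS r s" for s b
    using B[OF that(1)] s_e[OF that(1)] underS_e not_zero_timeI[OF that(2)] underS_irrefl
    by (auto simp: valid_def enter_def len_eq)
  \<comment> \<open>Later than b0 means not at time 0, where the initial block would
    intervene.\<close>
  obtain b0 where b0: "b0 \<in> underS r t"
    using t(1) by (auto simp: limit_time_def zero_time_def)
  have ev: "\<forall>\<^sub>F s in before r t. s \<in> underS r t \<and> b0 \<in> underS r s"
    using eventually_before_underS[OF r t(1)] eventually_before_later[OF r t(1) b0]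
    by (rule eventually_conj)
  have run: "\<exists>s'. succ_time r s s' \<and> s' \<in> underS r t \<and>
      (\<forall>k<T. safe n (\<lambda>j. {fst (B s) j, enc (fst (C s) j), enc (fst (C s') j)}) (fst ((sim ^^ k) (B s))) \<and>
      snd ((sim ^^ k) (B s)) \<ge> start n P (snd (C s)))"
    if s: "s \<in> underS r t" "b \<in> underS r s" for s b
  proof -
    obtain s' where s': "succ_time r s s'" "s' \<in> underS r t"
      using limit_time_next[OF r t(1) s(1)] by blast
    then show ?thesis
      using step_run_at(1)[OF s_e[OF s(1)] inv(1)[OF s] s'(1) underS_e[OF s_e[OF s'(2)]]] by auto
  qed
  have safe: "\<forall>\<^sub>F a in ?F. safe n (\<lambda>_. UNIV) (fst (fine B a))"
  proof (rule eventually_before_rr[OF t], rule eventually_mono[OF ev])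
    fix s assume s: "s \<in> underS r t \<and> b0 \<in> underS r s"
    then show "\<forall>k<len s. safe n (\<lambda>_. UNIV) (fst (fine B (tick s k)))"
      using run[of s b0] inv(2)[of s b0] safe_mono by fastforce
  qed
  define I where "I = snd (C t)"
  \<comment> \<open>A time before the limit has a next time, so its snapshot is not halted.\<close>
  have C_pc: "snd (C s) \<le> length P" if "s \<in> underS r t" for s
    using next_time[OF s_e[OF that]] by (metis halted_def less_imp_le not_le option.distinct(1) step_def)
  have I: "I = liminf_pc r t (\<lambda>s. snd (C s))"
    unfolding I_def by (rule C_limit_pc[OF t' t(1)])
  have I_spec: "\<forall>\<^sub>F s in before r t. I \<le> snd (C s)" "\<exists>\<^sub>F s in before r t. snd (C s) = I"
    unfolding I by (rule liminf_pc_spec[OF r t(1)], erule C_pc)+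
  have pc: "liminf_pc rr (tick t 0) (\<lambda>a. snd (fine B a)) = start n P I"
  proof (rule liminf_pc_eqI[OF rr])
    fix a assume "a \<in> underS rr (tick t 0)"
    then have a: "mac a \<in> underS r t" "mic a < len (mac a)"
      by (simp_all add: underS_rr_tick_0[OF t] times_def)
    then have "mac a \<noteq> e"
      using s_e[OF a(1)] by auto
    with a have "step (simulator n P) (fine B a) \<noteq> None"
      using valid_step[OF underS_e[OF s_e] B, of "mac a" "mic a"] by simp
    then show "snd (fine B a) \<le> length (simulator n P)"
      by (auto simp: step_def halted_def split: if_splits)
  next
    have ev_I: "\<forall>\<^sub>F s in before r t. (s \<in> underS r t \<and> b0 \<in> underS r s) \<and> I \<le> snd (C s)"
      by (rule eventually_conj[OF ev I_spec(1)])
    show "\<forall>\<^sub>F a in ?F. start n P I \<le> snd (fine B a)"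
    proof (rule eventually_before_rr[OF t], rule eventually_mono[OF ev_I])
      fix s assume s: "(s \<in> underS r t \<and> b0 \<in> underS r s) \<and> I \<le> snd (C s)"
      then have "start n P I \<le> start n P (snd (C s))"
        unfolding start_def by (intro mult_right_mono) auto
      then show "\<forall>k<len s. start n P I \<le> snd (fine B (tick s k))"
        using s run[of s b0] inv(2)[of s b0] by fastforce
    qed
    show "\<exists>\<^sub>F a in ?F. snd (fine B a) \<le> start n P I"
    proof (rule frequently_before_rr[OF t],
        rule frequently_elim1[OF frequently_eventually_frequently[OF I_spec(2) ev]])
      fix s assume s: "snd (C s) = I \<and> s \<in> underS r t \<and> b0 \<in> underS r s"
      then show "\<exists>k<len s. snd (fine B (tick s k)) \<le> start n P I"
        using inv[of s b0] len by (intro exI[of _ 0]) (auto simp: inv_at_def)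
    qed
  qed
  have "\<exists>\<sigma>. \<forall>j. \<bar>\<sigma> j\<bar> \<le> 1 \<and> has_liminf (before r t) (\<lambda>s. enc (fst (C s) j)) (\<sigma> j)"
    by (intro choice allI has_liminf_enc_exists[OF r t(1)])
  then obtain \<sigma> where \<sigma>: "\<And>j. \<bar>\<sigma> j\<bar> \<le> 1"
    "\<And>j. has_liminf (before r t) (\<lambda>s. enc (fst (C s) j)) (\<sigma> j)"
    by blast
  have fine_\<sigma>: "has_liminf ?F (\<lambda>a. fst (fine B a) j) (\<sigma> j)" if j: "j \<in> {1..n}" for j
  proof (rule has_liminfI)
    fix y assume "y < \<sigma> j"
    \<comment> \<open>At a limit time s the bound y' on earlier codes passes to the limit inferior
      only as \<open>\<le>\<close>; the gap between y and y' restores strictness.\<close>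
    then obtain y' where y': "y < y'" "y' < \<sigma> j"
      using dense by blast
    from has_liminfD(1)[OF \<sigma>(2) y'(2)] obtain b where b: "b \<in> underS r t"
      and low: "\<And>s. s \<in> underS r t \<Longrightarrow> b \<in> underS r s \<Longrightarrow> y' < enc (fst (C s) j)"
      unfolding eventually_before[OF r t(1)] by blast
    show "\<forall>\<^sub>F a in ?F. y < fst (fine B a) j"
    proof (rule eventually_before_rr[OF t], rule eventually_mono[OF eventually_conj[OF
            eventually_before_underS[OF r t(1)] eventually_before_later[OF r t(1) b]]])
      fix s assume s: "s \<in> underS r t \<and> b \<in> underS r s"
      then obtain s' where s': "succ_time r s s'" "s' \<in> underS r t"
        and safe: "\<And>k. k < T \<Longrightarrow>
          safe n (\<lambda>j. {fst (B s) j, enc (fst (C s) j), enc (fst (C s') j)}) (fst ((sim ^^ k) (B s)))"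
        using run[of s b] by blast
      \<comment> \<open>The new content, the code at s', already appears during the block of s, so
        the bound has to hold at s' too.\<close>
      have "b \<in> underS r s'"
        using s s'(1) underS_trans[OF r] by (auto simp: succ_time_def)
      then have "y < enc (fst (C s) j)" "y < enc (fst (C s') j)"
        using low[of s] low[of s'] s s'(2) y'(1) by auto
      \<comment> \<open>The critical case is a limit time s, where the entry content need not be the
        code at s; but it is the limit inferior of codes that are above y' after b.\<close>
      moreover have "y < fst (B s) j"
      proof (cases "limit_time r s")
        case True
        have "y' \<le> fst (B s) j"
        proof (rule ccontr)
          assume "\<not> y' \<le> fst (B s) j"
          moreover have "has_liminf (before r s) (\<lambda>s. enc (fst (C s) j)) (fst (B s) j)"
            using inv(1)[of s b] s True j by (simp add: inv_at_def)
          ultimately have "\<exists>\<^sub>F g in before r s. enc (fst (C g) j) < y'"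
            by (simp add: has_liminfD(2))
          moreover have "\<forall>\<^sub>F g in before r s. g \<in> underS r s \<and> b \<in> underS r g"
            using eventually_before_underS[OF r True] eventually_before_later[OF r True] s
            by (simp add: eventually_conj)
          ultimately obtain g where "enc (fst (C g) j) < y'" "g \<in> underS r s" "b \<in> underS r g"
            using eventually_frequently_ex[OF r True] by blast
          then show False
            using low[of g] underS_trans[OF r, of g s t] s by auto
        qed
        then show ?thesis
          using y'(1) by simp
      next
        case False
        then show ?thesis
          using inv(1)[of s b] s j \<open>y < enc (fst (C s) j)\<close> by (simp add: inv_at_def)
      qed
      ultimately have low: "y < v" if "v \<in> {fst (B s) j, enc (fst (C s) j), enc (fst (C s') j)}" for v
        using that by blast
      show "\<forall>k<len s. y < fst (fine B (tick s k)) j"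
      proof (intro allI impI)
        fix k assume "k < len s"
        then have "k < T"
          using inv(2)[of s b] s by simp
        from safe[OF this] show "y < fst (fine B (tick s k)) j"
          using j by (intro low) (simp add: safe_def)
      qed
    qed
  next
    fix y assume "\<sigma> j < y"
    from has_liminfD(2)[OF \<sigma>(2) this]
    have fr: "\<exists>\<^sub>F s in before r t. enc (fst (C s) j) < y" .
    show "\<exists>\<^sub>F a in ?F. fst (fine B a) j < y"
    proof (rule frequently_before_rr[OF t],
        rule frequently_elim1[OF frequently_eventually_frequently[OF fr ev]])
      fix s assume s: "enc (fst (C s) j) < y \<and> s \<in> underS r t \<and> b0 \<in> underS r s"
      then obtain s' where s': "succ_time r s s'" "s' \<in> underS r t"
        using limit_time_next[OF r t(1)] by blast
      show "\<exists>k<len s. fst (fine B (tick s k)) j < y"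
        using step_run_at(3)[OF s_e _ s'(1) underS_e[OF s_e[OF s'(2)]], of "B s"]
          inv[of s b0] s j by fastforce
    qed
  qed
  have ex: "\<exists>v. SITBM rr (tick t 0) (\<lambda>a. fst (fine B a) i) v \<and>
      (i \<in> {1..n} \<longrightarrow> v = \<sigma> i) \<and> (i \<in> {n+1..2*n} \<longrightarrow> 0 \<le> v) \<and>
      (i = 2*n+1 \<longrightarrow> -1 \<le> v) \<and> (i = 2*n+2 \<longrightarrow> v = 0)" if i: "i \<in> {1..2*n+2}" for i
  proof -
    consider "i \<in> {1..n}" | "i \<in> {n+1..2*n}" | "i = 2*n+1" | "i = 2*n+2"
      using i by fastforce
    then show ?thesis
    proof cases
      case 1
      then show ?thesis
        using has_liminf_SITBM[OF rr fine_\<sigma>] by auto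
    next
      case 2
      then have j: "i - n \<in> {1..n}" "n + (i - n) = i"
        by auto
      have "\<forall>\<^sub>F a in ?F. 0 \<le> fst (fine B a) i"
        by (rule eventually_mono[OF safe]) (use j in \<open>metis safe_def\<close>)
      from bounded_below_SITBM[OF rr this] 2 show ?thesis
        by auto
    next
      case 3
      have "\<forall>\<^sub>F a in ?F. -1 \<le> fst (fine B a) i"
        by (rule eventually_mono[OF safe]) (simp add: 3 safe_def)
      from bounded_below_SITBM[OF rr this] 3 show ?thesis
        by auto
    next
      case 4
      have zero: "\<forall>\<^sub>F a in ?F. fst (fine B a) i = 0"
        by (rule eventually_mono[OF safe]) (simp add: 4 safe_def)
      have "has_liminf ?F (\<lambda>a. fst (fine B a) i) 0"
      proof (rule has_liminfI)
        show "\<forall>\<^sub>F a in ?F. y < fst (fine B a) i" if "y < 0" for y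
          using zero that by (auto elim: eventually_mono)
        show "\<exists>\<^sub>F a in ?F. fst (fine B a) i < y" if "y > 0" for y
          by (rule frequently_elim1[OF eventually_before_imp_frequently[OF rr zero]]) (use that in simp)
      qed
      from has_liminf_SITBM[OF rr this] 4 show ?thesis
        by auto
    qed
  qed
  have "\<exists>X. \<forall>i\<in>{1..2*n+2}. SITBM rr (tick t 0) (\<lambda>a. fst (fine B a) i) (X i) \<and>
      (i \<in> {1..n} \<longrightarrow> X i = \<sigma> i) \<and> (i \<in> {n+1..2*n} \<longrightarrow> 0 \<le> X i) \<and>
      (i = 2*n+1 \<longrightarrow> -1 \<le> X i) \<and> (i = 2*n+2 \<longrightarrow> X i = 0)"
    by (rule bchoice, rule ballI, rule ex)
  then obtain X where *: "\<forall>i\<in>{1..2*n+2}. SITBM rr (tick t 0) (\<lambda>a. fst (fine B a) i) (X i) \<and>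
      (i \<in> {1..n} \<longrightarrow> X i = \<sigma> i) \<and> (i \<in> {n+1..2*n} \<longrightarrow> 0 \<le> X i) \<and>
      (i = 2*n+1 \<longrightarrow> -1 \<le> X i) \<and> (i = 2*n+2 \<longrightarrow> X i = 0)" ..
  then have X: "\<And>i. i \<in> {1..2*n+2} \<Longrightarrow> SITBM rr (tick t 0) (\<lambda>a. fst (fine B a) i) (X i)"
    by blast
  have X\<sigma>: "X i = \<sigma> i" if "i \<in> {1..n}" for i
    using * that by simp
  have "0 \<le> X i" if "i \<in> {n+1..2*n}" for i
    using * that by simp
  moreover have "-1 \<le> X (2*n+1)" "X (2*n+2) = 0"
    using bspec[OF *, of "2*n+1"] bspec[OF *, of "2*n+2"] by simp_all
  ultimately have "safe n (\<lambda>_. UNIV) X"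
    by (auto simp: safe_def)
  moreover have "represents n (fst (C t)) X"
    unfolding represents_def
    using X\<sigma> \<sigma> SSITBM_eq_dec[OF r t(1) \<sigma>(1,2) C_limit[OF t' t(1)]] by auto
  ultimately have "inv_at t (X, start n P I)"
    using t(1) X\<sigma> \<sigma>(2) by (simp add: inv_at_def I_def)
  with X pc show ?thesis
    by (intro exI[of _ "(X, start n P I)"]) simp
qed

section \<open>Construction of the whole simulating run\<close>

lemma valid_cong:
  assumes "\<And>s. s \<in> underS r t \<Longrightarrow> B s = B' s"
  shows "valid B t c = valid B' t c"
proof (cases "t \<in> under r e")
  case True
  have "B s = B' s" if "succ_time r s t" for s
    using that assms unfolding succ_time_def by blast
  moreover have "SITBM rr (tick t 0) (\<lambda>a. fst (fine B a) i) = SITBM rr (tick t 0) (\<lambda>a. fst (fine B' a) i)"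
    "liminf_pc rr (tick t 0) (\<lambda>a. snd (fine B a)) = liminf_pc rr (tick t 0) (\<lambda>a. snd (fine B' a))"
    if "limit_time r t" for i
    using assms underS_rr_tick_0[OF that True] by (auto intro!: SITBM_cong liminf_pc_cong)
  ultimately show ?thesis
    by (auto simp: valid_def)
qed (simp add: valid_def)

lemma valid_exists_next:
  assumes B: "\<And>s. s \<in> underS r t \<Longrightarrow> valid B s (B s)"
  shows "\<exists>c. valid B t c"
proof (cases "t \<in> under r e")
  case True
  consider "zero_time r t" | s where "succ_time r s t" | "limit_time r t"
    by (auto simp: limit_time_def)
  then show ?thesis
  proof cases
    case 1
    obtain Y where "(sim ^^ T) (init x) = (Y, start n P 0)" "safe n (\<lambda>_. UNIV) Y"
      "\<forall>j\<in>{1..n}. Y j = enc (fst (init x) j)"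
      using init_run(2)[OF n, folded T] by blast
    moreover have "C t = init x" "snd (init x) = 0"
      using C_zero[OF under_e_Field[OF True] 1] by (simp_all add: init_def)
    ultimately have "inv_at t (enter t (init x))"
      using 1 represents_enc[of n Y] by (simp add: inv_at_def enter_def limit_time_def)
    then have "valid B t (init x)"
      using 1 by (auto simp: valid_def succ_time_def zero_time_def limit_time_def)
    then show ?thesis ..
  next
    case (2 s)
    then have s: "s \<in> underS r t" "s \<in> underS r e"
      using under_e_closed[OF True] by (auto simp: succ_time_def)
    then have "inv_at s (enter s (B s))" "s \<noteq> e"
      using B[OF s(1)] underS_e by (auto simp: valid_def)
    then have "inv_at t ((sim ^^ len s) (B s))"
      using step_run_at(2)[OF s(2) _ 2 True] by (simp add: sim_len)
    moreover have "\<not> zero_time r t" "\<not> limit_time r t"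
      using 2 not_zero_timeI[OF s(1)] by (auto simp: limit_time_def)
    ultimately have "valid B t ((sim ^^ len s) (B s))"
      using succ_time_unique[OF r 2] by (auto simp: valid_def enter_def)
    then show ?thesis ..
  next
    case 3
    then have "\<not> zero_time r t" "\<not> succ_time r s t" for s
      by (auto simp: limit_time_def)
    with limit_exists[OF 3 True B] show ?thesis
      by (auto simp: valid_def enter_def)
  qed
qed (simp add: valid_def)

lemma simulator_halts: "halts_with (SITBM :: 'o limit_rule) (2 * n + 2) (simulator n P) x (fst (C e) 1)"
proof -
  have "\<exists>B. \<forall>t. valid B t (B t)"
  proof (rule dependent_wf_choice[OF wf_underS[OF r]])
    show "valid B t c = valid B' t c" if "\<And>s. (s, t) \<in> {(s, t). s \<in> underS r t} \<Longrightarrow> B s = B' s"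
      for B B' t c
      by (rule valid_cong) (simp add: that)
    show "\<exists>c. valid B t c" if "\<And>s. (s, t) \<in> {(s, t). s \<in> underS r t} \<Longrightarrow> valid B s (B s)" for B t
      by (rule valid_exists_next) (simp add: that)
  qed
  then obtain B where B: "\<And>t. valid B t (B t)"
    by blast
  have e_under: "e \<in> under r e"
    using under_eq[OF r e] by simp
  have comp: "computation SITBM (2 * n + 2) (simulator n P) x rr (fine B)"
    using valid_step[OF _ B] B by (intro refined_computation) (auto simp: valid_def)
  \<comment> \<open>The length of e ends in + 1, so this tick is T steps after the entry into the
    output block.\<close>
  define a where "a = tick e (len e - 1)"
  have a: "a \<in> Field rr"
    unfolding a_def Field_rr using e_under len by (intro tick_in_times) auto
  have fine_a: "fine B a = (sim ^^ T) (enter e (B e))"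
    by (simp add: a_def len_eq enter_def funpow_add)
  let ?c = "enter e (B e)"
  have c: "(fst ?c, start n P (snd (C e))) = ?c" "safe n (\<lambda>_. UNIV) (fst ?c)"
    "represents n (fst (C e)) (fst ?c)" "halted P (fst (C e), snd (C e))"
    using B[of e] e_under halted by (auto simp: valid_def inv_at_def prod_eq_iff)
  have "halted (simulator n P) (fine B a) \<and> fst (fine B a) 1 = fst (C e) 1"
    unfolding fine_a using halted_run(2,3)[OF P c(2-4), unfolded c(1), folded T] ..
  with comp a show ?thesis
    unfolding halts_with_def by blast
qed

end

text \<open>An infinite set absorbs the factor \<open>nat\<close>; thus the finite refinement of
  times stays within the bound that the type puts on computations.\<close>

lemma ex_bij_times_nat:
  assumes "infinite (UNIV :: 'o set)"
  shows "\<exists>h :: 'o \<Rightarrow> 'o \<times> nat. bij h"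
proof -
  include cardinal_syntax
  have "|UNIV :: nat set| \<le>o |UNIV :: 'o set|"
    using assms infinite_iff_card_of_nat by blast
  then have "|(UNIV :: 'o set) \<times> (UNIV :: nat set)| =o |UNIV :: 'o set|"
    using card_of_Times_infinite[OF assms] by blast
  then have "|UNIV :: 'o set| =o |UNIV :: ('o \<times> nat) set|"
    using ordIso_symmetric by fastforce
  then show ?thesis
    using card_of_ordIso[of "UNIV :: 'o set" "UNIV :: ('o \<times> nat) set"] by blast
qed

lemma computable_SSITBM_imp_SITBM:
  fixes f :: "real \<Rightarrow> real"
  assumes "infinite (UNIV :: 'o set)" and "computable (SSITBM :: 'o limit_rule) f"
  shows "computable (SITBM :: 'o limit_rule) f"
proof -
  obtain n P where P: "BSS_program n P" and f: "\<And>x. halts_with (SSITBM :: 'o limit_rule) n P x (f x)"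
    using assms(2) unfolding computable_def by blast
  obtain h :: "'o \<Rightarrow> 'o \<times> nat" where h: "bij h"
    using ex_bij_times_nat[OF assms(1)] by blast
  have "halts_with (SITBM :: 'o limit_rule) (2 * n + 2) (simulator n P) x (f x)" for x
  proof -
    obtain r :: "'o rel" and C e where run: "computation SSITBM n P x r C" "e \<in> Field r"
      "halted P (C e)" "fst (C e) 1 = f x"
      using f[of x] unfolding halts_with_def by blast
    interpret simulation r e "\<lambda>s. (if zero_time r s then block_time n else 0) + block_time n +
      (if s = e then 1 else 0)" h n P x C "block_time n"
      using run P h by unfold_locales (auto simp: computation_def)
    show ?thesis
      using simulator_halts run(4) by simp
  qed
  then show ?thesis
    unfolding computable_def using BSS_program_simulator[OF P] by blast
qed

theorem lemma8:
  fixes f :: "real \<Rightarrow> real"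
  assumes "infinite (UNIV :: 'o set)"
  shows "computable (SITBM :: 'o limit_rule) f \<longleftrightarrow> computable (SSITBM :: 'o limit_rule) f"
proof
  assume "computable (SITBM :: 'o limit_rule) f"
  then show "computable (SSITBM :: 'o limit_rule) f"
    unfolding computable_def halts_with_def using computation_SITBM_imp_SSITBM by metis
next
  assume "computable (SSITBM :: 'o limit_rule) f"
  with assms show "computable (SITBM :: 'o limit_rule) f"
    by (rule computable_SSITBM_imp_SITBM)
qed

end
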